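(* Let $G=(G_1,\dots,G_N):\mathbb{R}^N\to\mathbb{R}^N$ be a discretized Hamiltonian on a uniform periodic grid of $\mathbb{T}^d$ with $N$ points and spacing $h$, and let $k>0$ be an integer. Suppose that: (A3) for each $1\leq i\leq N$, the map $U\mapsto G_i(U)$ is convex on $\mathbb{R}^N$; (A4) for each $1\leq i,j\leq N$, the partial derivative $\partial_jG_i$ is locally Lipschitz on $\mathbb{R}^N$; (A5) there is a constant $\varrho$ such that for all $U=(u_1,\dots,u_N)$, $V=(v_1,\dots,v_N)\in\mathbb{R}^N$, $$\frac{1}{h^2}\sum_{i=1}^{d}\sum_{j=1}^{N}\left(\Gamma(i,u_j)-\Gamma(i,v_j)\right)^2\leq\varrho\sum_{j=1}^{N}\left(G_j(U)-G_j(V)-\nabla G_j(V)^T(U-V)\right);$$ (A6) for each $1\leq j\leq N$, $G_j(U+s)=G_j(U)$ for all $U\in\mathbb{R}^N$, $s\in\mathbb{R}$, where $U+s=(u_1+s,\dots,u_N+s)$. Let $(M^0,U^0)\in\mathbb{R}^N_+\times\mathbb{R}^N$ with $\frac1N\sum_{i=1}^N m_i^0=1$ and $\frac1N\sum_{i=1}^N u_i^0=0$. Then the initial value problem $$\begin{bmatrix}\dot M\\ \dot U\end{bmatrix}=-\overline{F}\begin{bmatrix}M\\ U\end{bmatrix},\qquad M(0)=M^0,\ U(0)=U^0,$$ admits a unique solution $(M(t),U(t))=(m_1(t),\dots,m_N(t),u_1(t),\dots,u_N(t))$ on $[0,+\infty)$. Let $(M^*,U^* )$, with $M^*=(m_1^*,\dots,m_N^*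 )$ and $U^*=(u_1^*,\dots,u_N^* )$, solve the discrete stationary problem $$\widetilde F\begin{bmatrix}M^*\\ U^*\end{bmatrix}=0,\qquad m_i^*>0,\qquad \frac1N\sum_{i=1}^N m_i^*=1 .$$ Then, for each $1\leq j\leq N$, as $t\to\infty$, $u_j(t)\to u_j^*$ and $m_j(t)\to m_j^*$.
   Context: $\mathbb{R}^N_+$ is the set of vectors in $\mathbb{R}^N$ with strictly positive components. The uniform grid on the unit torus $\mathbb{T}^d$ has points $x_1,\dots,x_N$, with periodic convention and spacing $h$. A vector $U=(u_1,\dots,u_N)$ represents grid values at $x_1,\dots,x_N$. $\Gamma(i,u_j)$ denotes the forward difference of the grid function $U$ at grid vertex $x_j$ in coordinate direction $i$ (value at the next grid point in direction $i$, with periodicity, minus $u_j$, up to sign convention). $G:\mathbb{R}^N\to\mathbb{R}^N$ is a differentiable map; it is meant as a finite-difference approximation $G_i(U)\approx H(x_i,P+D_xu(x_i))$ of a Hamiltonian $H$, for a fixed $P\in\mathbb{R}^d$. $\mathcal{L}_U:\mathbb{R}^N\to\mathbb{R}^N$ is the linearized operator (Jacobian) of $G$ at $U$ and $\mathcal{L}_U^*$ its adjoint (transpose). For $(M,U)\in\mathbb{R}^N_+\times\mathbb{R}^N$ set $$\widetilde H(M,U)=\frac{\sum_{i=1}^{N}\left(m_iG_i(U)-\frac1k m_i\ln m_i\right)}{\sum_{i=1}^{N}m_i}.$$ The operators $\widetilde F,\overline F:\mathbb{R}^N_+\times\mathbb{R}^N\to\mathbb{R}^N\times\mathbb{R}^N$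 are defined as follows: the $j$-th component ($1\le j\le N$) of the first block of $\widetilde F(M,U)$ is $-G_j(U)+\widetilde H(M,U)+\frac1k\ln m_j$; the $j$-th component of the first block of $\overline F(M,U)$ is $m_j\left(-G_j(U)+\widetilde H(M,U)+\frac1k\ln m_j\right)$; the $j$-th component of the second block of both is $(\mathcal{L}_U^*M)_j$. Solutions of the flow take values in $\mathbb{R}^N_+\times\mathbb{R}^N$.
   Formalization: The convergence u_j(t)→u_j^* is claimed only for U^* with mean zero, since by (A6) adding a constant to U^* gives another stationary solution while the flow keeps the mean of U at zero; m_j(t)→m_j^* is proved for every stationary solution. *)

theory Defs
  imports "HOL-Analysis.Analysis"
begin

text \<open>
  The uniform periodic grid on the unit torus has \<open>n\<close> points per coordinate direction and spacing
  \<open>h = 1/n\<close>. The type \<open>'N\<close> indexes the grid points; \<open>c j\<close> is the multi-index of vertex \<open>j\<close>, so the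
  vertex is the point \<open>x j\<close> of the torus with coordinates \<open>x j i = h * c j i\<close>. The enumeration is
  arbitrary.
\<close>

definition uniform_periodic_grid ::
    "nat \<Rightarrow> real \<Rightarrow> ('N::finite \<Rightarrow> 'd::finite \<Rightarrow> nat) \<Rightarrow> bool" where
  "uniform_periodic_grid n h c \<longleftrightarrow>
     n > 0 \<and> h = 1 / real n \<and> bij_betw c UNIV {a. \<forall>i. a i < n}"

definition next_vertex ::
    "nat \<Rightarrow> ('N::finite \<Rightarrow> 'd::finite \<Rightarrow> nat) \<Rightarrow> 'd \<Rightarrow> 'N \<Rightarrow> 'N" where
  "next_vertex n c i j = inv c ((c j)(i := (c j i + 1) mod n))"

lemma next_vertex_coords:
  assumes "uniform_periodic_grid n h c"
  shows "c (next_vertex n c i j) = (c j)(i := (c j i + 1) mod n)"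
proof -
  have n: "n > 0" and b: "bij_betw c UNIV {a. \<forall>i. a i < n}"
    using assms by (auto simp: uniform_periodic_grid_def)
  have "c j \<in> {a. \<forall>i. a i < n}"
    using b by (auto simp: bij_betw_def)
  then have "(c j)(i := (c j i + 1) mod n) \<in> {a. \<forall>i. a i < n}"
    using n by auto
  then have "(c j)(i := (c j i + 1) mod n) \<in> range c"
    using b by (simp add: bij_betw_def)
  then show ?thesis
    unfolding next_vertex_def by (rule f_inv_into_f)
qed

lemma card_grid:
  fixes c :: "'N::finite \<Rightarrow> 'd::finite \<Rightarrow> nat"
  assumes "uniform_periodic_grid n h c"
  shows "CARD('N) = n ^ CARD('d)"
proof -
  have "bij_betw c UNIV {a. \<forall>i. a i < n}"
    using assms by (simp add: uniform_periodic_grid_def)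
  moreover have "{a :: 'd \<Rightarrow> nat. \<forall>i. a i < n} = PiE UNIV (\<lambda>_. {..<n})"
    by auto
  ultimately have "CARD('N) = card (PiE (UNIV :: 'd set) (\<lambda>_. {..<n}))"
    using bij_betw_same_card by metis
  then show ?thesis
    by (simp add: card_PiE)
qed

definition forward_diff ::
    "nat \<Rightarrow> ('N::finite \<Rightarrow> 'd::finite \<Rightarrow> nat) \<Rightarrow> real ^ 'N \<Rightarrow> 'd \<Rightarrow> 'N \<Rightarrow> real" where
  "forward_diff n c U i j = U $ next_vertex n c i j - U $ j"

definition positive_vec :: "real ^ 'N::finite \<Rightarrow> bool" where
  "positive_vec M \<longleftrightarrow> (\<forall>i. M $ i > 0)"

definition grid_mean :: "real ^ 'N::finite \<Rightarrow> real" where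
  "grid_mean V = (1 / real CARD('N)) * (\<Sum>i\<in>UNIV. V $ i)"

definition locally_lipschitz :: "('a::metric_space \<Rightarrow> 'b::metric_space) \<Rightarrow> bool" where
  "locally_lipschitz f \<longleftrightarrow> (\<forall>x. \<exists>e>0. \<exists>L. L-lipschitz_on (ball x e) f)"

text \<open>
  The \<open>(i, j)\<close> entry of \<open>linearization G U\<close> is the partial derivative of the \<open>i\<close>-th component of
  \<open>G\<close> with respect to \<open>u j\<close>, and its \<open>i\<close>-th row is the gradient of that component.
\<close>

definition linearization :: "(real ^ 'N \<Rightarrow> real ^ 'N) \<Rightarrow> real ^ 'N \<Rightarrow> real ^ 'N ^ 'N::finite" where
  "linearization G U = jacobian G (at U)"

definition partial_deriv :: "(real ^ 'N \<Rightarrow> real ^ 'N) \<Rightarrow> 'N \<Rightarrow> 'N \<Rightarrow> real ^ 'N::finite \<Rightarrow> real" where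
  "partial_deriv G j i U = linearization G U $ i $ j"

definition grad :: "(real ^ 'N \<Rightarrow> real ^ 'N) \<Rightarrow> 'N \<Rightarrow> real ^ 'N \<Rightarrow> real ^ 'N::finite" where
  "grad G j V = linearization G V $ j"

definition adjoint_linearization ::
    "(real ^ 'N \<Rightarrow> real ^ 'N) \<Rightarrow> real ^ 'N \<Rightarrow> real ^ 'N \<Rightarrow> real ^ 'N::finite" where
  "adjoint_linearization G U M = transpose (linearization G U) *v M"

definition H_tilde ::
    "(real ^ 'N \<Rightarrow> real ^ 'N) \<Rightarrow> nat \<Rightarrow> real ^ 'N \<Rightarrow> real ^ 'N::finite \<Rightarrow> real" where
  "H_tilde G k M U =
     (\<Sum>i\<in>UNIV. M $ i * G U $ i - (1 / real k) * (M $ i) * ln (M $ i)) / (\<Sum>i\<in>UNIV. M $ i)"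

definition F_tilde ::
    "(real ^ 'N \<Rightarrow> real ^ 'N) \<Rightarrow> nat \<Rightarrow> (real ^ 'N) \<times> (real ^ 'N)
       \<Rightarrow> (real ^ 'N) \<times> (real ^ 'N::finite)" where
  "F_tilde G k = (\<lambda>(M, U).
     ((\<chi> j. - (G U $ j) + H_tilde G k M U + (1 / real k) * ln (M $ j)),
      adjoint_linearization G U M))"

definition F_bar ::
    "(real ^ 'N \<Rightarrow> real ^ 'N) \<Rightarrow> nat \<Rightarrow> (real ^ 'N) \<times> (real ^ 'N)
       \<Rightarrow> (real ^ 'N) \<times> (real ^ 'N::finite)" where
  "F_bar G k = (\<lambda>(M, U).
     ((\<chi> j. M $ j * (- (G U $ j) + H_tilde G k M U + (1 / real k) * ln (M $ j))),
      adjoint_linearization G U M))"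

text \<open>
  At \<open>t = 0\<close> the derivative below is one-sided. Values of \<open>z\<close> at negative times are irrelevant.
\<close>

definition solves_flow ::
    "(real ^ 'N \<Rightarrow> real ^ 'N) \<Rightarrow> nat \<Rightarrow> real ^ 'N \<Rightarrow> real ^ 'N
       \<Rightarrow> (real \<Rightarrow> (real ^ 'N) \<times> (real ^ 'N::finite)) \<Rightarrow> bool" where
  "solves_flow G k M0 U0 z \<longleftrightarrow>
     z 0 = (M0, U0) \<and>
     (\<forall>t\<ge>0. positive_vec (fst (z t)) \<and>
        (z has_vector_derivative - F_bar G k (z t)) (at t within {0..}))"

definition solves_stationary ::
    "(real ^ 'N \<Rightarrow> real ^ 'N) \<Rightarrow> nat \<Rightarrow> real ^ 'N \<Rightarrow> real ^ 'N::finite \<Rightarrow> bool" where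
  "solves_stationary G k M U \<longleftrightarrow>
     F_tilde G k (M, U) = 0 \<and> positive_vec M \<and> grid_mean M = 1"

end

theory Submission
  imports Defs
begin

text \<open>
  The flow is a gradient-like system for the saddle point problem that the stationary equations
  express, and the proof rests on one Lyapunov function: the Kullback-Leibler divergence of a reference
  density from \<open>M\<close> plus half the squared distance from \<open>U\<close> to a reference \<open>Ur\<close>
  (\<open>lyapunov\<close>). Along the flow its derivative is minus a dissipation plus a residual
  (\<open>lyapunov_derivative_along_flow\<close>). The dissipation consists of Bregman distances of the convex functions
  \<open>G j\<close> and of a monotonicity term of the logarithm, and is nonnegative for every reference with positive density; the
  residual measures how far the reference is from being stationary. The identity is used twice.

  With the reference \<open>(1, 0)\<close> the residual is controlled by the Lyapunov function itself, so
  that function grows at most exponentially. On bounded time intervals this confines every solution to a compact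
  set of positive densities (\<open>flow_a_priori_bound\<close>). The vector field is
  Lipschitz on such sets, and \<open>global_solution_if_bounded_a_priori\<close> turns the two facts into a unique
  global solution: the field is truncated outside a compact convex set, the truncated equation is solved by a
  weighted contraction argument, and the bound shows that the truncation is never felt.

  With a stationary reference the residual vanishes and the Lyapunov function decreases, so the
  trajectory stays in a fixed compact set. The flow conserves the total mass and the mean of \<open>U\<close>; among
  states with these values the dissipation vanishes only at the stationary state
  (\<open>dissipation_positive\<close>). Convergence follows from \<open>lyapunov_convergence\<close>.
\<close>

section \<open>Global solutions of autonomous differential equations\<close>

text \<open>
  The derivative is taken within the time set \<open>I\<close>, hence one-sided at its end points. This lets one
  notion serve both for the solutions on \<open>{0..T}\<close> of the construction and for the solution on \<open>{0..}\<close>.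
\<close>
definition solution_on ::
    "('a::real_normed_vector \<Rightarrow> 'a) \<Rightarrow> 'a set \<Rightarrow> 'a \<Rightarrow> real set \<Rightarrow> (real \<Rightarrow> 'a) \<Rightarrow> bool" where
  "solution_on f S x0 I z \<longleftrightarrow> z 0 = x0 \<and>
     (\<forall>t\<in>I. z t \<in> S \<and> (z has_vector_derivative f (z t)) (at t within I))"

lemma solution_on_subset:
  assumes "solution_on f S x0 I z" "J \<subseteq> I"
  shows "solution_on f S x0 J z"
  using assms unfolding solution_on_def
  by (meson has_vector_derivative_within_subset subsetD)

lemma solution_on_continuous:
  assumes "solution_on f S x0 I z"
  shows "continuous_on I z"
  using assms unfolding solution_on_def
  by (auto intro!: continuous_on_vector_derivative)

lemma nonincreasing_if_derivative_nonpos: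
  fixes g :: "real \<Rightarrow> real"
  assumes "a \<le> b"
    and D: "\<And>t. t \<in> {a..b} \<Longrightarrow> (g has_real_derivative g' t) (at t within {a..b})"
    and N: "\<And>t. t \<in> {a..b} \<Longrightarrow> g' t \<le> 0"
  shows "g b \<le> g a"
proof (rule DERIV_nonpos_imp_decreasing_open[where f = g and a = a and b = b])
  show "a \<le> b" by fact
  show "continuous_on {a..b} g"
    by (rule DERIV_continuous_on) (rule D)
  fix x assume x: "a < x" "x < b"
  then show "\<exists>y. (g has_real_derivative y) (at x) \<and> y \<le> 0"
    using D[of x] N[of x] by (auto simp: at_within_Icc_at)
qed

text \<open>
  Gronwall argument: along two solutions the Lipschitz bound gives
  \<open>(|z - w|\<^sup>2)' \<le> 2 L |z - w|\<^sup>2\<close>, so \<open>exp (- 2 L t) |z - w|\<^sup>2\<close> cannot grow from its initial value \<open>0\<close>.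
\<close>
lemma solutions_coincide_if_lipschitz:
  fixes f :: "'a::real_inner \<Rightarrow> 'a"
  assumes z: "solution_on f S x0 {0..T} z" and w: "solution_on f S x0 {0..T} w"
    and L: "L-lipschitz_on K f"
    and K: "\<And>t. t \<in> {0..T} \<Longrightarrow> z t \<in> K \<and> w t \<in> K"
    and t: "t \<in> {0..T}"
  shows "z t = w t"
proof -
  define g where "g = (\<lambda>t. exp (-2*L * t) * ((z t - w t) \<bullet> (z t - w t)))"
  define g' where "g' = (\<lambda>t. exp (-2*L * t) * (2 * ((z t - w t) \<bullet> (f (z t) - f (w t))))
      - 2 * L * exp (-2*L * t) * ((z t - w t) \<bullet> (z t - w t)))"
  have "g t \<le> g 0"
  proof (rule nonincreasing_if_derivative_nonpos[where g = g and g' = g'])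
    show "0 \<le> t" using t by simp
    fix s assume s: "s \<in> {0..t}"
    have sub: "{0..t} \<subseteq> {0..T}" using t by auto
    have "(z has_vector_derivative f (z s)) (at s within {0..t})"
      and "(w has_vector_derivative f (w s)) (at s within {0..t})"
      using solution_on_subset[OF z sub] solution_on_subset[OF w sub] s
      by (auto simp: solution_on_def)
    then have d: "((\<lambda>t. z t - w t) has_vector_derivative (f (z s) - f (w s))) (at s within {0..t})"
      by (rule has_vector_derivative_diff)
    have i: "((\<lambda>t. (z t - w t) \<bullet> (z t - w t)) has_real_derivative
       2 * ((z s - w s) \<bullet> (f (z s) - f (w s)))) (at s within {0..t})"
      unfolding has_real_derivative_iff_has_vector_derivative
      using bounded_bilinear.has_vector_derivative[OF bounded_bilinear_inner d d]
      by (simp add: inner_commute)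
    show "(g has_real_derivative g' s) (at s within {0..t})"
      unfolding g_def g'_def
      by (rule derivative_eq_intros i refl)+ (simp add: algebra_simps)
    have "(z s - w s) \<bullet> (f (z s) - f (w s)) \<le> norm (z s - w s) * norm (f (z s) - f (w s))"
      by (rule norm_cauchy_schwarz)
    also have "\<dots> \<le> norm (z s - w s) * (L * norm (z s - w s))"
      using lipschitz_on_normD[OF L] K[of s] s sub by (intro mult_left_mono) auto
    also have "\<dots> = L * ((z s - w s) \<bullet> (z s - w s))"
      by (simp add: dot_square_norm power2_eq_square)
    finally have "exp (-2*L * s) * ((z s - w s) \<bullet> (f (z s) - f (w s)))
       \<le> exp (-2*L * s) * (L * ((z s - w s) \<bullet> (z s - w s)))"
      by (intro mult_left_mono) auto
    then show "g' s \<le> 0"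
      unfolding g'_def by (simp add: algebra_simps)
  qed
  also have "g 0 = 0"
    using z w by (simp add: g_def solution_on_def)
  finally have "(z t - w t) \<bullet> (z t - w t) \<le> 0"
    by (simp add: g_def mult_le_0_iff)
  then show ?thesis
    using inner_ge_zero[of "z t - w t"] inner_eq_zero_iff[of "z t - w t"] by force
qed

lemma solution_within_Ici:
  assumes z0: "z 0 = x0"
    and z: "\<And>T. T \<ge> 0 \<Longrightarrow> solution_on f S x0 {0..T} z"
  shows "solution_on f S x0 {0..} z"
  unfolding solution_on_def
proof (intro conjI ballI)
  show "z 0 = x0" by fact
  fix t :: real assume t: "t \<in> {0..}"
  then have "solution_on f S x0 {0..t+1} z" by (intro z) auto
  then have *: "z t \<in> S" "(z has_vector_derivative f (z t)) (at t within {0..t+1})"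
    using t by (auto simp: solution_on_def)
  have "at t within {0..t+1} = at t within {0..}"
    by (rule at_within_nhd[of t "{..<t+1}"]) auto
  then show "z t \<in> S" "(z has_vector_derivative f (z t)) (at t within {0..})"
    using * by simp_all
qed

text \<open>
  Picard iteration on the whole half line at once. In the unknown \<open>y t = exp (- l t) z t\<close> the integral
  equation for \<open>z\<close> becomes a fixed point equation whose map \<open>Q\<close> is a contraction of the bounded continuous
  functions as soon as \<open>l\<close> exceeds the Lipschitz constant; boundedness of \<open>f\<close> makes \<open>z\<close> grow at
  most linearly, so that \<open>y\<close> is bounded.
\<close>
lemma bounded_lipschitz_global_solution:
  fixes f :: "'a::euclidean_space \<Rightarrow> 'a"
  assumes L: "L-lipschitz_on UNIV f" and B: "\<And>x. norm (f x) \<le> B"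
  shows "\<exists>z. solution_on f UNIV x0 {0..} z"
proof -
  \<comment> \<open>The contraction factor of the weighted map is \<open>L / l\<close>, here at most \<open>1 / 2\<close>;
    the summand \<open>1\<close> keeps \<open>l\<close> positive when \<open>L = 0\<close>.\<close>
  define l where "l = 2 * L + 1"
  have L0: "L \<ge> 0" using L by (rule lipschitz_on_nonneg)
  have l: "l > 0" "L \<le> l / 2" using L0 by (auto simp: l_def)
  have B0: "B \<ge> 0" using B norm_ge_zero order_trans by blast
  have fc: "continuous_on UNIV f"
    using L by (rule lipschitz_on_continuous_on)
  define P :: "(real \<Rightarrow> 'a) \<Rightarrow> real \<Rightarrow> 'a" where
    "P y t = x0 + integral {0..t} (\<lambda>s. f (exp (l * s) *\<^sub>R y s))" for y t
  \<comment> \<open>The type of bounded continuous functions has all of the reals as domain, so negative times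
    are assigned the value at time \<open>0\<close>.\<close>
  define Q where "Q y t = exp (-l * max t 0) *\<^sub>R P y (max t 0)" for y t
  have int: "continuous_on A (\<lambda>s. f (exp (l * s) *\<^sub>R y s))" if "continuous_on UNIV y" for y A
  proof (rule continuous_on_compose2[OF fc])
    show "continuous_on A (\<lambda>s. exp (l * s) *\<^sub>R y s)"
      by (intro continuous_intros) (rule continuous_on_subset[OF that], simp)
  qed simp
  have intb: "(\<lambda>s. f (exp (l * s) *\<^sub>R y s)) integrable_on {0..t}" if "continuous_on UNIV y" for y t
    by (intro integrable_continuous_real int that)
  have Pd: "(P y has_vector_derivative f (exp (l * t) *\<^sub>R y t)) (at t within {0..T})"
    if "continuous_on UNIV y" "t \<in> {0..T}" for y t T
  proof -
    have "((\<lambda>t. x0 + integral {0..t} (\<lambda>s. f (exp (l * s) *\<^sub>R y s))) has_vector_derivative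
         0 + f (exp (l * t) *\<^sub>R y t)) (at t within {0..T})"
      by (intro has_vector_derivative_add has_vector_derivative_const
          integral_has_vector_derivative int that)
    then show ?thesis by (simp add: P_def[abs_def])
  qed
  have Qb: "Q y \<in> bcontfun" if y: "continuous_on UNIV y" for y
  proof (rule bcontfun_normI)
    have "isCont (\<lambda>t. P y (max t 0)) t" for t
    proof -
      have c: "continuous_on {0..\<bar>t\<bar>+1} (P y)"
        by (rule continuous_on_vector_derivative) (rule Pd[OF y])
      have "continuous_on {-\<bar>t\<bar>-1..\<bar>t\<bar>+1} (\<lambda>t. P y (max t 0))"
        by (rule continuous_on_compose2[OF c]) (auto intro!: continuous_intros)
      then show ?thesis
        by (rule continuous_on_interior) (auto simp: interior_atLeastAtMost_real)
    qed
    then show "continuous_on UNIV (Q y)"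
      unfolding Q_def[abs_def]
      by (intro continuous_intros) (simp add: continuous_at_imp_continuous_on)
    fix t :: real
    let ?t = "max t 0"
    have "norm (P y ?t) \<le> norm x0 + norm (integral {0..?t} (\<lambda>s. f (exp (l * s) *\<^sub>R y s)))"
      unfolding P_def by (rule norm_triangle_ineq)
    also have "norm (integral {0..?t} (\<lambda>s. f (exp (l * s) *\<^sub>R y s))) \<le> B * (?t - 0)"
      by (rule integral_bound) (auto intro: int[OF y] B)
    finally have "norm (P y ?t) \<le> norm x0 + B * ?t" by simp
    also have "\<dots> \<le> exp (l * ?t) * (norm x0 + B / l)"
    proof -
      have "1 + l * ?t \<le> exp (l * ?t)" by (rule exp_ge_add_one_self)
      moreover have "0 \<le> l * ?t" using l by simp
      ultimately have "1 \<le> exp (l * ?t)" "l * ?t \<le> exp (l * ?t)" by linarith+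
      then have "1 * norm x0 + (l * ?t) * (B / l) \<le> exp (l * ?t) * norm x0 + exp (l * ?t) * (B/l)"
        using l B0 by (intro add_mono mult_right_mono) auto
      then show ?thesis using l by (simp add: algebra_simps)
    qed
    finally have "exp (-l * ?t) * norm (P y ?t) \<le> exp (-l * ?t) * (exp (l * ?t) * (norm x0 + B / l))"
      by (intro mult_left_mono) auto
    then show "norm (Q y t) \<le> norm x0 + B / l"
      unfolding Q_def by (simp add: mult.assoc[symmetric] exp_add[symmetric])
  qed
  define R :: "(real \<Rightarrow>\<^sub>C 'a) \<Rightarrow> (real \<Rightarrow>\<^sub>C 'a)" where "R y = Bcontfun (Q (apply_bcontfun y))" for y
  have R: "apply_bcontfun (R y) = Q (apply_bcontfun y)" for y
    unfolding R_def by (rule Bcontfun_inverse) (intro Qb, simp)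
  have contr: "dist (R y) (R w) \<le> (1/2) * dist y w" for y w
  proof (rule dist_bound)
    fix t :: real
    let ?t = "max t 0" and ?y = "apply_bcontfun y" and ?w = "apply_bcontfun w"
    let ?d = "dist y w"
    let ?D = "\<lambda>s. f (exp (l * s) *\<^sub>R ?y s) - f (exp (l * s) *\<^sub>R ?w s)"
    have y: "continuous_on UNIV ?y" and w: "continuous_on UNIV ?w" by simp_all
    have E: "((\<lambda>s. exp (l * s)) has_integral (exp (l * ?t) / l - exp (l*0) / l)) {0..?t}"
    proof (rule fundamental_theorem_of_calculus)
      fix x :: real
      have "((\<lambda>s. exp (l * s) / l) has_real_derivative exp (l*x)) (at x within {0..?t})"
        using l by (auto intro!: derivative_eq_intros)
      then show "((\<lambda>s. exp (l * s) / l) has_vector_derivative exp (l*x)) (at x within {0..?t})"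
        by (simp add: has_real_derivative_iff_has_vector_derivative)
    qed simp
    have "norm (integral {0..?t} ?D) \<le> integral {0..?t} (\<lambda>s. L * ?d * exp (l * s))"
    proof (rule integral_norm_bound_integral)
      show "?D integrable_on {0..?t}"
        by (intro integrable_diff intb y w)
      show "(\<lambda>s. L * ?d * exp (l * s)) integrable_on {0..?t}"
        using has_integral_mult_right[OF E] by blast
      fix s assume "s \<in> {0..?t}"
      have "norm (?D s) \<le> L * norm (exp (l * s) *\<^sub>R ?y s - exp (l * s) *\<^sub>R ?w s)"
        by (rule lipschitz_on_normD[OF L]) auto
      also have "exp (l * s) *\<^sub>R ?y s - exp (l * s) *\<^sub>R ?w s = exp (l * s) *\<^sub>R (?y s - ?w s)"
        by (simp add: scaleR_diff_right)
      also have "L * norm \<dots> \<le> L * (exp (l * s) * ?d)"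
        using L0 dist_bounded[of y s w] by (intro mult_left_mono) (auto simp: dist_norm)
      finally show "norm (?D s) \<le> L * ?d * exp (l * s)" by (simp add: mult_ac)
    qed
    also have "\<dots> = L * ?d * (exp (l * ?t) / l - exp (l*0) / l)"
      using has_integral_mult_right[OF E] by (rule integral_unique)
    also have "\<dots> \<le> L * ?d * (exp (l * ?t) / l)"
      using L0 l by (intro mult_left_mono) auto
    also have "\<dots> = (L / l) * (?d * exp (l * ?t))" by simp
    also have "\<dots> \<le> (1/2) * (?d * exp (l * ?t))"
      using l by (intro mult_right_mono) (auto simp: field_simps)
    finally have "exp (-l * ?t) * norm (integral {0..?t} ?D) \<le> exp (-l * ?t) * ((1/2) * (?d * exp (l * ?t)))"
      by (intro mult_left_mono) auto
    also have "\<dots> = (exp (-l * ?t) * exp (l * ?t)) * ((1/2) * ?d)" by simp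
    also have "\<dots> = (1/2) * ?d" by (simp add: exp_add[symmetric])
    finally have *: "exp (-l * ?t) * norm (integral {0..?t} ?D) \<le> (1/2) * ?d" .
    have "P ?y ?t - P ?w ?t = integral {0..?t} ?D"
      unfolding P_def by (subst integral_diff) (auto intro!: intb y w)
    then have "Q ?y t - Q ?w t = exp (-l * ?t) *\<^sub>R integral {0..?t} ?D"
      unfolding Q_def by (simp add: scaleR_diff_right[symmetric])
    then show "dist (R y t) (R w t) \<le> (1/2) * ?d"
      using * unfolding R dist_norm by simp
  qed
  have "\<exists>!y. R y = y"
    by (rule banach_fix_type[where c = "1/2"]) (use contr in auto)
  then obtain y where "R y = y" by blast
  then have yt: "apply_bcontfun y t = Q (apply_bcontfun y) t" for t
    using R[of y] by simp
  define z where "z = P (apply_bcontfun y)"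
  have z: "exp (l * t) *\<^sub>R y t = z t" if "t \<ge> 0" for t
    using that by (subst yt) (simp add: Q_def z_def exp_add[symmetric])
  have "solution_on f UNIV x0 {0..} z"
  proof (rule solution_within_Ici)
    show z0: "z 0 = x0" by (simp add: z_def P_def)
    fix T :: real
    show "solution_on f UNIV x0 {0..T} z"
      unfolding solution_on_def
    proof (intro conjI ballI z0 UNIV_I)
      fix t assume t: "t \<in> {0..T}"
      then show "(z has_vector_derivative f (z t)) (at t within {0..T})"
        using Pd[OF continuous_on_apply_bcontfun[of UNIV y] t] z[of t] by (simp add: z_def)
    qed
  qed
  then show ?thesis by blast
qed

text \<open>
  The convex hull of two trajectories over a bounded time interval is compact, and convexity of \<open>S\<close>
  keeps it in \<open>S\<close>; there the vector field has one Lipschitz constant.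
\<close>
lemma solutions_coincide:
  fixes f :: "'a::euclidean_space \<Rightarrow> 'a"
  assumes S: "convex S"
    and lip: "\<And>K. compact K \<Longrightarrow> convex K \<Longrightarrow> K \<subseteq> S \<Longrightarrow> \<exists>L. L-lipschitz_on K f"
    and z: "solution_on f S x0 {0..T} z" and w: "solution_on f S x0 {0..T} w"
    and t: "t \<in> {0..T}"
  shows "z t = w t"
proof -
  define K where "K = convex hull (z ` {0..T} \<union> w ` {0..T})"
  have "compact K"
    unfolding K_def
    by (intro compact_convex_hull compact_Un compact_continuous_image
        solution_on_continuous[OF z] solution_on_continuous[OF w]) auto
  moreover have "K \<subseteq> S"
    unfolding K_def using z w S by (intro hull_minimal) (auto simp: solution_on_def)
  moreover have "convex K" unfolding K_def by simp
  ultimately obtain L where "L-lipschitz_on K f" using lip by blast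
  moreover have "z s \<in> K \<and> w s \<in> K" if "s \<in> {0..T}" for s
    using that unfolding K_def by (auto intro: hull_inc)
  ultimately show ?thesis
    by (rule solutions_coincide_if_lipschitz[OF z w _ _ t])
qed

lemma compact_convex_neighbourhood:
  fixes S :: "'a::euclidean_space set"
  assumes "open S" "convex S" "compact C" "C \<subseteq> S"
  obtains K where "compact K" "convex K" "C \<subseteq> interior K" "K \<subseteq> S"
proof -
  have "compact (convex hull C)" "convex hull C \<subseteq> S"
    using assms by (auto intro: compact_convex_hull subsetD[OF hull_minimal])
  then obtain e where e: "e > 0" "(\<Union>x\<in>convex hull C. cball x e) \<subseteq> S"
    using compact_subset_open_imp_cball_epsilon_subset[OF _ \<open>open S\<close>] by metis
  define K where "K = {x + y | x y. x \<in> convex hull C \<and> y \<in> cball 0 e}"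
  show thesis
  proof
    show "compact K"
      unfolding K_def by (intro compact_sums \<open>compact (convex hull C)\<close> compact_cball)
    have "K = (\<Union>x\<in>convex hull C. \<Union>y\<in>cball 0 e. {x + y})"
      unfolding K_def by (auto, blast)
    then show "convex K"
      by (simp add: convex_sums)
    show "K \<subseteq> S"
    proof
      fix v assume "v \<in> K"
      then obtain x y where "x \<in> convex hull C" "y \<in> cball 0 e" "v = x + y"
        by (auto simp: K_def)
      then have "v \<in> cball x e" by (simp add: dist_norm)
      then show "v \<in> S" using e \<open>x \<in> convex hull C\<close> by blast
    qed
    show "C \<subseteq> interior K"
    proof
      fix x assume x: "x \<in> C"
      have "ball x e \<subseteq> K"
      proof
        fix v assume "v \<in> ball x e"
        then have "v - x \<in> cball 0 e" by (simp add: dist_norm norm_minus_commute)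
        moreover have "v = x + (v - x)" by simp
        ultimately show "v \<in> K" using hull_inc[OF x] unfolding K_def by blast
      qed
      then show "x \<in> interior K"
        using \<open>e > 0\<close> by (meson centre_in_ball interior_maximal open_ball subsetD)
    qed
  qed
qed

text \<open>
  Outside a compact convex neighbourhood \<open>K\<close> of the a priori region \<open>C\<close>, the field is replaced by its
  value at the closest point of \<open>K\<close>. The result is bounded and Lipschitz on the whole space, hence has a global solution.
  At the first time at which that solution leaves the interior of \<open>K\<close> it has only seen the
  original field, so the a priori bound places it in \<open>C\<close>, inside the interior: there is no such
  time up to \<open>T\<close>.
\<close>
lemma solution_up_to:
  fixes f :: "'a::euclidean_space \<Rightarrow> 'a"
  assumes S: "open S" "convex S"
    and lip: "\<And>K. compact K \<Longrightarrow> convex K \<Longrightarrow> K \<subseteq> S \<Longrightarrow> \<exists>L. L-lipschitz_on K f"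
    and x0: "x0 \<in> S" and T: "T \<ge> 0"
    and C: "compact C" "C \<subseteq> S"
    and apriori: "\<And>s z. 0 \<le> s \<Longrightarrow> s \<le> T \<Longrightarrow> solution_on f S x0 {0..s} z \<Longrightarrow> z s \<in> C"
  shows "\<exists>z. solution_on f S x0 {0..T} z"
proof -
  have "compact (insert x0 C)" "insert x0 C \<subseteq> S" using C x0 by auto
  then obtain K where K: "compact K" "convex K" "insert x0 C \<subseteq> interior K" "K \<subseteq> S"
    using compact_convex_neighbourhood[OF S] by metis
  then have ne: "K \<noteq> {}" using interior_subset by blast
  have cl: "closed K" using K(1) by (rule compact_imp_closed)
  obtain L where L: "L-lipschitz_on K f" using lip K by blast
  define g where "g x = f (closest_point K x)" for x
  have inK: "closest_point K x \<in> K" for x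
    by (rule closest_point_in_set[OF cl ne])
  have gL: "L-lipschitz_on UNIV g"
  proof (rule lipschitz_onI)
    show "L \<ge> 0" using L by (rule lipschitz_on_nonneg)
    fix x y
    have "dist (g x) (g y) \<le> L * dist (closest_point K x) (closest_point K y)"
      unfolding g_def by (rule lipschitz_onD[OF L inK inK])
    also have "\<dots> \<le> L * dist x y"
      by (intro mult_left_mono closest_point_lipschitz K cl ne \<open>L \<ge> 0\<close>)
    finally show "dist (g x) (g y) \<le> L * dist x y" .
  qed
  have "compact (f ` K)"
    by (intro compact_continuous_image lipschitz_on_continuous_on[OF L] K)
  then obtain B where "\<forall>x\<in>f ` K. norm x \<le> B"
    using compact_imp_bounded bounded_iff by metis
  then have B: "norm (g x) \<le> B" for x using inK by (simp add: g_def)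
  obtain z where z: "solution_on g UNIV x0 {0..} z"
    using bounded_lipschitz_global_solution[OF gL B] by blast
  have zc: "continuous_on {0..} z" by (rule solution_on_continuous[OF z])
  have z0: "z 0 = x0" using z by (simp add: solution_on_def)
  have sol: "solution_on f S x0 {0..s} z" if "\<And>r. r \<in> {0..s} \<Longrightarrow> z r \<in> K" for s
  proof -
    have "solution_on g UNIV x0 {0..s} z" by (rule solution_on_subset[OF z]) auto
    moreover have "g (z r) = f (z r)" if "r \<in> {0..s}" for r
      using \<open>r \<in> {0..s} \<Longrightarrow> z r \<in> K\<close> that by (simp add: g_def closest_point_self)
    ultimately show ?thesis using that K by (auto simp: solution_on_def)
  qed
  have stay: "z r \<in> interior K" if r: "r \<in> {0..T}" for r
  proof (rule ccontr)
    assume nr: "z r \<notin> interior K"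
    define E where "E = {0..T} \<inter> z -` (- interior K)"
    have "closed E"
      unfolding E_def
      by (intro continuous_closed_preimage continuous_on_subset[OF zc] closed_atLeastAtMost)
        (auto simp: closed_Compl)
    then have "compact E"
      by (metis E_def compact_Icc compact_Int_closed inf_le1 inf.absorb_iff2)
    moreover have "E \<noteq> {}" using r nr by (auto simp: E_def)
    ultimately obtain s where s: "s \<in> E" "\<And>t. t \<in> E \<Longrightarrow> s \<le> t"
      using compact_attains_inf[of E] by auto
    have "s \<noteq> 0" using s(1) K z0 by (auto simp: E_def)
    then have s0: "0 < s" "s \<le> T" using s(1) by (auto simp: E_def)
    have before: "z ` {0..<s} \<subseteq> K"
      using s(2) s0 interior_subset[of K] by (force simp: E_def)
    have "z ` closure {0..<s} \<subseteq> K"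
      by (rule image_closure_subset[OF _ cl before])
        (rule continuous_on_subset[OF zc], use s0 in auto)
    then have "solution_on f S x0 {0..s} z"
      using s0 by (intro sol) auto
    then have "z s \<in> C" using s0 by (intro apriori) auto
    then show False using s(1) K by (auto simp: E_def)
  qed
  then show ?thesis
    using sol[of T] interior_subset[of K] by blast
qed

text \<open>
  Solutions on \<open>{0..T}\<close> exist for all \<open>T\<close> and agree on common intervals by uniqueness, so they glue.
\<close>
theorem global_solution_if_bounded_a_priori:
  fixes f :: "'a::euclidean_space \<Rightarrow> 'a"
  assumes S: "open S" "convex S"
    and lip: "\<And>K. compact K \<Longrightarrow> convex K \<Longrightarrow> K \<subseteq> S \<Longrightarrow> \<exists>L. L-lipschitz_on K f"
    and x0: "x0 \<in> S"
    and apriori: "\<And>T. T \<ge> 0 \<Longrightarrow> \<exists>C. compact C \<and> C \<subseteq> S \<and>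
       (\<forall>s z. 0 \<le> s \<longrightarrow> s \<le> T \<longrightarrow> solution_on f S x0 {0..s} z \<longrightarrow> z s \<in> C)"
  shows "\<exists>z. solution_on f S x0 {0..} z \<and> 
           (\<forall>w. solution_on f S x0 {0..} w \<longrightarrow> (\<forall>t\<ge>0. w t = z t))"
proof -
  have "\<exists>z. solution_on f S x0 {0..T} z" if T: "T \<ge> 0" for T
  proof -
    obtain C where C: "compact C" "C \<subseteq> S"
      "\<And>s z. 0 \<le> s \<Longrightarrow> s \<le> T \<Longrightarrow> solution_on f S x0 {0..s} z \<Longrightarrow> z s \<in> C"
      using apriori[OF T] by blast
    show ?thesis by (rule solution_up_to[where S = S and C = C]) (use S lip x0 T C in blast)+
  qed
  then obtain Z where Z: "\<And>T. T \<ge> 0 \<Longrightarrow> solution_on f S x0 {0..T} (Z T)" by metis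
  define z where "z t = Z t t" for t
  have eq: "z t = Z T t" if "t \<in> {0..T}" for t T
  proof -
    have "{0..t} \<subseteq> {0..T}" "T \<ge> 0" "t \<ge> 0" using that by auto
    then have "solution_on f S x0 {0..t} (Z t)" "solution_on f S x0 {0..t} (Z T)"
      using Z solution_on_subset by blast+
    then show ?thesis
      unfolding z_def using that by (intro solutions_coincide[OF S(2) lip]) auto
  qed
  have z: "solution_on f S x0 {0..} z"
  proof (rule solution_within_Ici)
    show "z 0 = x0" using Z[of 0] by (simp add: z_def solution_on_def)
    fix T :: real assume T: "T \<ge> 0"
    show "solution_on f S x0 {0..T} z"
      unfolding solution_on_def
    proof (intro conjI ballI)
      show "z 0 = x0" by fact
      fix t assume t: "t \<in> {0..T}"
      have "z t = Z T t" by (rule eq[OF t])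
      moreover have "(Z T has_vector_derivative f (Z T t)) (at t within {0..T})" "Z T t \<in> S"
        using Z[OF T] t by (auto simp: solution_on_def)
      ultimately show "z t \<in> S" "(z has_vector_derivative f (z t)) (at t within {0..T})"
        using has_vector_derivative_transform[OF t, of z "Z T"] eq by auto
    qed
  qed
  moreover have "w t = z t" if w: "solution_on f S x0 {0..} w" and t: "t \<ge> 0" for w t
  proof (rule solutions_coincide[OF S(2) lip])
    show "solution_on f S x0 {0..t} w" "solution_on f S x0 {0..t} z"
      by (rule solution_on_subset[OF w], auto) (rule solution_on_subset[OF z], auto)
  qed (use t in auto)
  ultimately show ?thesis by blast
qed

section \<open>Convergence by a strict Lyapunov function\<close>

text \<open>
  While \<open>V (z t)\<close> stays above a level \<open>v > V p\<close>, the trajectory remains in a compact set that avoids \<open>p\<close>, on which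
  \<open>D\<close> has a positive lower bound; so \<open>V\<close> falls below \<open>v\<close> after a finite time, and stays there.
  Since \<open>p\<close> is the strict minimum of \<open>V\<close> on a compact set, small values of \<open>V\<close> force \<open>z t\<close> close to \<open>p\<close>.
\<close>
lemma lyapunov_convergence:
  fixes z :: "real \<Rightarrow> 'a::metric_space" and V D :: "'a \<Rightarrow> real"
  assumes K: "compact K" and zK: "\<And>t. t \<ge> 0 \<Longrightarrow> z t \<in> K"
    and V: "continuous_on K V" and D: "continuous_on K D"
    and Vp: "\<And>x. x \<in> K \<Longrightarrow> x \<noteq> p \<Longrightarrow> V x > V p"
    and D0: "\<And>x. x \<in> K \<Longrightarrow> D x \<ge> 0"
    and Dp: "\<And>x. x \<in> K \<Longrightarrow> x \<noteq> p \<Longrightarrow> D x > 0"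
    and deriv: "\<And>t. t \<ge> 0 \<Longrightarrow> ((\<lambda>t. V (z t)) has_real_derivative - D (z t)) (at t within {0..})"
  shows "(z \<longlongrightarrow> p) at_top"
proof (rule tendstoI)
  fix e :: real assume e: "e > 0"
  have deriv': "((\<lambda>t. V (z t)) has_real_derivative - D (z t)) (at t within {a..b})"
    if "0 \<le> a" "t \<in> {a..b}" for a b t
    using that by (intro has_field_derivative_subset[OF deriv]) auto
  have mono: "V (z b) \<le> V (z a)" if "0 \<le> a" "a \<le> b" for a b
    by (rule nonincreasing_if_derivative_nonpos[OF that(2) deriv'[OF that(1)]])
      (use that zK D0 in auto)
  have cpt: "compact {x\<in>K. v \<le> V x}" for v
  proof -
    have "compact (K \<inter> (K \<inter> V -` {v..}))"
      by (intro compact_Int_closed K continuous_closed_preimage V compact_imp_closed closed_atLeast)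
    moreover have "K \<inter> (K \<inter> V -` {v..}) = {x\<in>K. v \<le> V x}" by auto
    ultimately show ?thesis by simp
  qed
  have small: "\<exists>t\<ge>0. V (z t) < v" if v: "v > V p" for v
  proof (rule ccontr)
    assume "\<not> ?thesis"
    then have big: "V (z t) \<ge> v" if "t \<ge> 0" for t using that by force
    let ?A = "{x\<in>K. v \<le> V x}"
    have "?A \<noteq> {}" using zK[of 0] big[of 0] by auto
    moreover have "continuous_on ?A D" by (rule continuous_on_subset[OF D]) auto
    ultimately obtain x where x: "x \<in> ?A" "\<And>y. y \<in> ?A \<Longrightarrow> D x \<le> D y"
      using continuous_attains_inf[OF cpt] by blast
    have "x \<noteq> p" using x(1) v by auto
    then have d: "D x > 0" using Dp x(1) by auto
    \<comment> \<open>Decreasing at rate at least \<open>D x\<close>, the function \<open>V\<close> would be below \<open>v\<close> by this time.\<close>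
    define T where "T = (V (z 0) - v) / D x + 1"
    have T: "T > 0" using big[of 0] d by (auto simp: T_def intro: add_nonneg_pos)
    have "V (z T) + D x * T \<le> V (z 0) + D x * 0"
    proof (rule nonincreasing_if_derivative_nonpos[where g = "\<lambda>t. V (z t) + D x * t" and g' = "\<lambda>t. - D (z t) + D x"])
      fix t assume t: "t \<in> {0..T}"
      show "((\<lambda>t. V (z t) + D x * t) has_real_derivative - D (z t) + D x) (at t within {0..T})"
        by (auto intro!: derivative_eq_intros deriv' t)
      show "- D (z t) + D x \<le> 0" using x(2)[of "z t"] zK big t by auto
    qed (use T in simp)
    moreover have "D x * T = V (z 0) - v + D x" using d by (simp add: T_def field_simps)
    ultimately show False using big[of T] T d by auto
  qed
  have "\<exists>v>V p. \<forall>x\<in>K. V x < v \<longrightarrow> dist x p < e"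
  proof (cases "K - ball p e = {}")
    case True
    then show ?thesis by (intro exI[of _ "V p + 1"]) (auto simp: dist_commute)
  next
    case False
    have "compact (K - ball p e)" by (intro compact_diff K) simp
    moreover have "continuous_on (K - ball p e) V" by (rule continuous_on_subset[OF V]) auto
    ultimately obtain x where x: "x \<in> K - ball p e" "\<And>y. y \<in> K - ball p e \<Longrightarrow> V x \<le> V y"
      using continuous_attains_inf[OF _ False] by blast
    have "V x > V p" using x(1) e by (intro Vp) auto
    moreover have "dist y p < e" if "y \<in> K" "V y < V x" for y
      using that x(2)[of y] by (cases "y \<in> ball p e") (auto simp: dist_commute)
    ultimately show ?thesis by blast
  qed
  then obtain v where v: "v > V p" "\<And>x. x \<in> K \<Longrightarrow> V x < v \<Longrightarrow> dist x p < e" by blast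
  obtain t0 where t0: "t0 \<ge> 0" "V (z t0) < v" using small[OF v(1)] by blast
  show "\<forall>\<^sub>F t in at_top. dist (z t) p < e"
    using eventually_ge_at_top[of t0]
  proof eventually_elim
    case (elim t)
    then have "V (z t) < v" using mono[OF t0(1) elim] t0(2) by simp
    then show ?case using v(2) zK t0(1) elim by auto
  qed
qed

section \<open>Convexity and symmetry of the discrete Hamiltonian\<close>

text \<open>
  Reduction to the one-dimensional tangent inequality on the line through \<open>x\<close> and \<open>y\<close>.
\<close>
lemma convex_above_tangent_plane:
  fixes f :: "'a::real_normed_vector \<Rightarrow> real"
  assumes "convex_on UNIV f" and D: "(f has_derivative f') (at x)"
  shows "f x + f' (y - x) \<le> f y"
proof -
  define g where "g s = f (x + s *\<^sub>R (y - x))" for s :: real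
  have conv: "convex_on UNIV g"
  proof (intro convex_onI)
    fix t a b :: real
    assume t: "0 < t" "t < 1"
    have "x + ((1 - t) *\<^sub>R a + t *\<^sub>R b) *\<^sub>R (y - x)
        = (1 - t) *\<^sub>R (x + a *\<^sub>R (y - x)) + t *\<^sub>R (x + b *\<^sub>R (y - x))"
      by (simp add: algebra_simps)
    then show "g ((1 - t) *\<^sub>R a + t *\<^sub>R b) \<le> (1 - t) * g a + t * g b"
      unfolding g_def using convex_onD[OF assms(1), of t] t by simp
  qed simp
  have d: "((\<lambda>s. x + s *\<^sub>R (y - x)) has_derivative (\<lambda>s. s *\<^sub>R (y - x))) (at 0)"
    by (auto intro!: derivative_eq_intros)
  have D': "(f has_derivative f') (at (x + 0 *\<^sub>R (y - x)))" using D by simp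
  have "(g has_derivative (\<lambda>s. f' (s *\<^sub>R (y - x)))) (at 0)"
    using diff_chain_at[OF d D'] by (simp add: g_def[abs_def] o_def)
  moreover have "f' (s *\<^sub>R (y - x)) = f' (y - x) * s" for s
    using has_derivative_linear[OF D] by (simp add: linear_scale)
  ultimately have "(g has_real_derivative f' (y - x)) (at 0)"
    by (simp add: has_field_derivative_def)
  then have "g 1 - g 0 \<ge> f' (y - x) * (1 - 0)"
    by (intro convex_on_imp_above_tangent[OF conv]) auto
  then show ?thesis by (simp add: g_def)
qed

text \<open>
  The Bregman distance of the convex function \<open>G j\<close>: its excess at \<open>U\<close> over the tangent plane at \<open>V\<close>.
\<close>
definition bregman :: "(real ^ 'N \<Rightarrow> real ^ 'N) \<Rightarrow> 'N \<Rightarrow> real ^ 'N \<Rightarrow> real ^ 'N::finite \<Rightarrow> real" where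
  "bregman G j U V = G U $ j - G V $ j - grad G j V \<bullet> (U - V)"

lemma has_derivative_grad:
  fixes G :: "real ^ 'N \<Rightarrow> real ^ 'N::finite"
  assumes "G differentiable (at U)"
  shows "((\<lambda>U. G U $ j) has_derivative (\<lambda>v. grad G j U \<bullet> v)) (at U)"
proof -
  have "(G has_derivative (\<lambda>v. linearization G U *v v)) (at U)"
    using assms unfolding linearization_def by (simp add: jacobian_works[symmetric])
  from bounded_linear.has_derivative[OF bounded_linear_vec_nth this]
  show ?thesis by (simp add: grad_def matrix_vector_mul_component)
qed

lemma bregman_nonneg:
  assumes "G differentiable (at V)" "convex_on UNIV (\<lambda>U. G U $ j)"
  shows "bregman G j U V \<ge> 0"
  using convex_above_tangent_plane[OF assms(2) has_derivative_grad[OF assms(1)], of U]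
  by (simp add: bregman_def)

lemma adjoint_linearization_inner:
  "adjoint_linearization G U M \<bullet> W = (\<Sum>i\<in>UNIV. M $ i * (grad G i U \<bullet> W))"
proof -
  have "adjoint_linearization G U M \<bullet> W = M \<bullet> (linearization G U *v W)"
    by (simp add: adjoint_linearization_def transpose_matrix_vector dot_lmul_matrix)
  then show ?thesis
    by (simp add: inner_vec_def[of M] grad_def matrix_vector_mul_component)
qed

lemma grad_orthogonal_to_constants:
  fixes G :: "real ^ 'N \<Rightarrow> real ^ 'N::finite"
  assumes diff: "G differentiable (at U)" and shift: "\<And>s. G (U + vec s) $ j = G U $ j"
  shows "grad G j U \<bullet> vec 1 = 0"
proof -
  have "((\<lambda>s::real. U + s *\<^sub>R vec 1) has_derivative (\<lambda>s. s *\<^sub>R vec 1)) (at 0)"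
    by (auto intro!: derivative_eq_intros)
  moreover have "((\<lambda>U. G U $ j) has_derivative (\<lambda>v. grad G j U \<bullet> v)) (at (U + (0::real) *\<^sub>R vec 1))"
    using has_derivative_grad[OF diff] by simp
  ultimately have "((\<lambda>U. G U $ j) \<circ> (\<lambda>s::real. U + s *\<^sub>R vec 1) has_derivative
      (\<lambda>v. grad G j U \<bullet> v) \<circ> (\<lambda>s. s *\<^sub>R vec 1)) (at 0)"
    by (rule diff_chain_at)
  moreover have "(\<lambda>U. G U $ j) \<circ> (\<lambda>s::real. U + s *\<^sub>R vec 1) = (\<lambda>s. G U $ j)"
  proof
    fix s :: real
    have "s *\<^sub>R vec 1 = (vec s :: real ^ 'N)"
      by (simp add: vec_eq_iff)
    then show "((\<lambda>U. G U $ j) \<circ> (\<lambda>s::real. U + s *\<^sub>R vec 1)) s = G U $ j"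
      by (simp only: o_def shift)
  qed
  ultimately have "((\<lambda>s::real. G U $ j) has_derivative (\<lambda>v. grad G j U \<bullet> v) \<circ> (\<lambda>s. s *\<^sub>R vec 1)) (at 0)"
    by simp
  moreover have "((\<lambda>s::real. G U $ j) has_derivative (\<lambda>s. 0)) (at 0)"
    by (rule has_derivative_const)
  ultimately have "(\<lambda>v. grad G j U \<bullet> v) \<circ> (\<lambda>s. s *\<^sub>R vec 1) = (\<lambda>s::real. 0)"
    by (rule has_derivative_unique)
  from fun_cong[OF this, of 1] show ?thesis by simp
qed

text \<open>
  Needed to normalise a stationary \<open>U\<close> to mean zero while it remains stationary.
\<close>
lemma linearization_shift:
  fixes G :: "real ^ 'N \<Rightarrow> real ^ 'N::finite"
  assumes diff: "\<And>U. G differentiable (at U)" and shift: "\<And>U. G (U + v) = G U"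
  shows "linearization G (U + v) = linearization G U"
proof -
  have "(G has_derivative (\<lambda>h. linearization G (U + v) *v h)) (at (U + v))"
    using diff unfolding linearization_def by (simp add: jacobian_works[symmetric])
  moreover have "((\<lambda>U. U + v) has_derivative (\<lambda>h. h)) (at U)"
    by (auto intro!: derivative_eq_intros)
  ultimately have "(G \<circ> (\<lambda>U. U + v) has_derivative (\<lambda>h. linearization G (U + v) *v h) \<circ> (\<lambda>h. h)) (at U)"
    by (intro diff_chain_at)
  then have "(G has_derivative (\<lambda>h. linearization G (U + v) *v h)) (at U)"
    by (simp add: o_def shift)
  moreover have "(G has_derivative (\<lambda>h. linearization G U *v h)) (at U)"
    using diff unfolding linearization_def by (simp add: jacobian_works[symmetric])
  ultimately have "(\<lambda>h. linearization G (U + v) *v h) = (\<lambda>h. linearization G U *v h)"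
    by (rule has_derivative_unique)
  then show ?thesis by (simp add: matrix_eq fun_eq_iff)
qed

text \<open>
  The grid is connected by unit steps: every vertex is reached from the origin by increasing one
  coordinate at a time, and a function with vanishing forward differences does not change on the way.
  The induction is on the sum of the coordinates.
\<close>
lemma grid_function_constant:
  fixes c :: "'N::finite \<Rightarrow> 'd::finite \<Rightarrow> nat" and W :: "real ^ 'N"
  assumes grid: "uniform_periodic_grid n h c"
    and zero: "\<And>i j. forward_diff n c W i j = 0"
  shows "W $ j = W $ j'"
proof -
  have n: "n > 0" and b: "bij_betw c UNIV {a. \<forall>i. a i < n}"
    using grid by (auto simp: uniform_periodic_grid_def)
  have inj: "inj c" using b by (simp add: bij_betw_def)
  have lt: "c j i < n" for j i using b by (auto simp: bij_betw_def)
  have "\<forall>j o0. c o0 = (\<lambda>_. 0) \<longrightarrow> (\<Sum>i\<in>UNIV. c j i) = m \<longrightarrow> W $ j = W $ o0" for m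
  proof (induction m)
    case 0
    show ?case
    proof (intro allI impI)
      fix j o0 assume o0: "c o0 = (\<lambda>_. 0)" and "(\<Sum>i\<in>UNIV. c j i) = 0"
      then have "c j = c o0" by (auto simp: fun_eq_iff)
      then have "j = o0" by (rule injD[OF inj])
      then show "W $ j = W $ o0" by simp
    qed
  next
    case (Suc m)
    show ?case
    proof (intro allI impI)
      fix j o0 assume o0: "c o0 = (\<lambda>_. 0)" and s: "(\<Sum>i\<in>UNIV. c j i) = Suc m"
      then obtain i where i: "c j i > 0"
        by (metis gr0I nat.distinct(1) sum.neutral)
      let ?a = "(c j)(i := c j i - 1)"
      have "?a \<in> range c"
        using b lt[of j] by (auto simp: bij_betw_def less_imp_diff_less)
      then obtain j' where j': "c j' = ?a" by (metis imageE)
      have "(\<Sum>i\<in>UNIV. c j i) = c j i + (\<Sum>i\<in>UNIV - {i}. c j i)"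
        by (rule sum.remove) auto
      moreover have "(\<Sum>i\<in>UNIV. c j' i) = c j' i + (\<Sum>i\<in>UNIV - {i}. c j' i)"
        by (rule sum.remove) auto
      moreover have "(\<Sum>i\<in>UNIV - {i}. c j' i) = (\<Sum>i\<in>UNIV - {i}. c j i)"
        by (rule sum.cong) (auto simp: j')
      ultimately have "(\<Sum>i\<in>UNIV. c j' i) = m" using s i by (simp add: j')
      then have "W $ j' = W $ o0" using Suc o0 by blast
      moreover have "next_vertex n c i j' = j"
        using next_vertex_coords[OF grid, of i j'] j' i lt[of j i] inj
        by (simp add: inj_eq)
      then have "W $ j = W $ j'" using zero[of i j'] by (simp add: forward_diff_def)
      ultimately show "W $ j = W $ o0" by simp
    qed
  qed
  moreover have "(\<lambda>_. 0) \<in> range c" using b n by (auto simp: bij_betw_def)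
  then obtain o0 where "c o0 = (\<lambda>_. 0)" by (metis imageE)
  ultimately have "W $ i = W $ o0" for i by blast
  from this[of j] this[of j'] show ?thesis by simp
qed

section \<open>Lipschitz continuity of the flow field on compact sets\<close>

lemma lipschitz_on_of_bounded_linear:
  assumes "bounded_linear f"
  shows "\<exists>L. L-lipschitz_on K f"
  by (rule bounded_linear.lipschitz_boundE[OF assms]) (use lipschitz_on_subset in blast)

lemma lipschitz_on_sum_exists:
  fixes f :: "'i \<Rightarrow> 'a::metric_space \<Rightarrow> 'b::real_normed_vector"
  assumes "finite I" "\<And>i. i \<in> I \<Longrightarrow> \<exists>L. L-lipschitz_on K (f i)"
  shows "\<exists>L. L-lipschitz_on K (\<lambda>x. \<Sum>i\<in>I. f i x)"
  using assms
proof (induction rule: finite_induct)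
  case empty
  then show ?case by (auto intro: lipschitz_on_constant)
next
  case (insert i I)
  then obtain L M where "L-lipschitz_on K (f i)" "M-lipschitz_on K (\<lambda>x. \<Sum>i\<in>I. f i x)" by blast
  from lipschitz_on_add[OF this] show ?case using insert by auto
qed

lemma lipschitz_on_mult_exists:
  fixes f g :: "'a::metric_space \<Rightarrow> real"
  assumes "compact K" "\<exists>L. L-lipschitz_on K f" "\<exists>L. L-lipschitz_on K g"
  shows "\<exists>L. L-lipschitz_on K (\<lambda>x. f x * g x)"
proof -
  obtain L M where L: "L-lipschitz_on K f" and M: "M-lipschitz_on K g" using assms by blast
  have L0: "L \<ge> 0" "M \<ge> 0" using L M lipschitz_on_nonneg by blast+
  have "bounded (f ` K)" "bounded (g ` K)"
    using assms(1) L M lipschitz_on_continuous_on compact_continuous_image compact_imp_bounded by blast+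
  then obtain A B where A: "A > 0" "\<And>x. x \<in> K \<Longrightarrow> \<bar>f x\<bar> \<le> A" and B: "B > 0" "\<And>x. x \<in> K \<Longrightarrow> \<bar>g x\<bar> \<le> B"
    unfolding bounded_pos by auto
  have "(A * M + B * L)-lipschitz_on K (\<lambda>x. f x * g x)"
  proof (rule lipschitz_onI)
    fix x y assume xy: "x \<in> K" "y \<in> K"
    have "\<bar>f x * g x - f y * g y\<bar> = \<bar>f x * (g x - g y) + g y * (f x - f y)\<bar>"
      by (simp add: algebra_simps)
    also have "\<dots> \<le> \<bar>f x\<bar> * \<bar>g x - g y\<bar> + \<bar>g y\<bar> * \<bar>f x - f y\<bar>"
      by (simp add: abs_mult[symmetric])
    also have "\<dots> \<le> A * (M * dist x y) + B * (L * dist x y)"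
      using A B xy lipschitz_onD[OF L xy] lipschitz_onD[OF M xy]
      by (intro add_mono mult_mono) (auto simp: dist_real_def)
    finally show "dist (f x * g x) (f y * g y) \<le> (A * M + B * L) * dist x y"
      by (simp add: dist_real_def algebra_simps)
  qed (use A B L0 in auto)
  then show ?thesis by blast
qed

lemma positive_bounded_below_on_compact:
  fixes f :: "'a::metric_space \<Rightarrow> real"
  assumes "compact K" "continuous_on K f" "\<And>x. x \<in> K \<Longrightarrow> f x > 0"
  obtains e where "e > 0" "\<And>x. x \<in> K \<Longrightarrow> e \<le> f x"
proof (cases "K = {}")
  case True
  then show ?thesis using that[of 1] by simp
next
  case False
  then obtain x where "x \<in> K" "\<And>y. y \<in> K \<Longrightarrow> f x \<le> f y"
    using continuous_attains_inf[OF assms(1) _ assms(2)] by blast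
  then show ?thesis using that assms(3) by blast
qed

lemma lipschitz_on_ln_exists:
  fixes f :: "'a::metric_space \<Rightarrow> real"
  assumes K: "compact K" and f: "\<exists>L. L-lipschitz_on K f" and pos: "\<And>x. x \<in> K \<Longrightarrow> f x > 0"
  shows "\<exists>L. L-lipschitz_on K (\<lambda>x. ln (f x))"
proof -
  obtain L where L: "L-lipschitz_on K f" using f by blast
  obtain e where e: "e > 0" "\<And>x. x \<in> K \<Longrightarrow> e \<le> f x"
    using positive_bounded_below_on_compact[OF K lipschitz_on_continuous_on[OF L] pos] by blast
  have L0: "L \<ge> 0" using L lipschitz_on_nonneg by blast
  have *: "ln (f x) - ln (f y) \<le> (1 / e) * L * dist x y" if xy: "x \<in> K" "y \<in> K" for x y
  proof -
    have "ln (f x) - ln (f y) \<le> (f x - f y) / f y"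
      using pos xy by (intro ln_diff_le) auto
    also have "\<dots> \<le> (L * dist x y) / f y"
      using lipschitz_onD[OF L xy] pos[OF xy(2)] by (intro divide_right_mono) (auto simp: dist_real_def)
    also have "\<dots> \<le> (L * dist x y) / e"
      using e xy L0 by (intro divide_left_mono) (auto intro: mult_pos_pos less_le_trans)
    finally show ?thesis by simp
  qed
  have "((1 / e) * L)-lipschitz_on K (\<lambda>x. ln (f x))"
  proof (rule lipschitz_onI)
    fix x y assume "x \<in> K" "y \<in> K"
    then show "dist (ln (f x)) (ln (f y)) \<le> (1 / e) * L * dist x y"
      using *[of x y] *[of y x] by (auto simp: dist_real_def abs_le_iff dist_commute)
  qed (use e L0 in auto)
  then show ?thesis by blast
qed

lemma lipschitz_on_inverse_exists:
  fixes f :: "'a::metric_space \<Rightarrow> real"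
  assumes K: "compact K" and f: "\<exists>L. L-lipschitz_on K f" and pos: "\<And>x. x \<in> K \<Longrightarrow> f x > 0"
  shows "\<exists>L. L-lipschitz_on K (\<lambda>x. inverse (f x))"
proof -
  obtain L where L: "L-lipschitz_on K f" using f by blast
  obtain e where e: "e > 0" "\<And>x. x \<in> K \<Longrightarrow> e \<le> f x"
    using positive_bounded_below_on_compact[OF K lipschitz_on_continuous_on[OF L] pos] by blast
  have L0: "L \<ge> 0" using L lipschitz_on_nonneg by blast
  have "(L / (e * e))-lipschitz_on K (\<lambda>x. inverse (f x))"
  proof (rule lipschitz_onI)
    fix x y assume xy: "x \<in> K" "y \<in> K"
    have p: "f x > 0" "f y > 0" using pos xy by auto
    have "\<bar>inverse (f x) - inverse (f y)\<bar> = \<bar>f x - f y\<bar> / (f x * f y)"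
      using p by (simp add: inverse_diff_inverse abs_mult abs_minus_commute divide_inverse)
    also have "\<dots> \<le> (L * dist x y) / (f x * f y)"
      using lipschitz_onD[OF L xy] p by (intro divide_right_mono) (auto simp: dist_real_def)
    also have "\<dots> \<le> (L * dist x y) / (e * e)"
      using e xy L0 p by (intro divide_left_mono mult_mono) auto
    finally show "dist (inverse (f x)) (inverse (f y)) \<le> L / (e * e) * dist x y"
      by (simp add: dist_real_def)
  qed (use e L0 in auto)
  then show ?thesis by blast
qed

lemma lipschitz_on_vec_exists:
  fixes f :: "'a::metric_space \<Rightarrow> real ^ 'n::finite"
  assumes "\<And>i. \<exists>L. L-lipschitz_on K (\<lambda>x. f x $ i)"
  shows "\<exists>L. L-lipschitz_on K f"
proof -
  obtain L where L: "\<And>i. (L i)-lipschitz_on K (\<lambda>x. f x $ i)" using assms by metis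
  have "(\<Sum>i\<in>UNIV. L i)-lipschitz_on K f"
  proof (rule lipschitz_onI)
    show "0 \<le> (\<Sum>i\<in>UNIV. L i)" using L lipschitz_on_nonneg by (intro sum_nonneg) blast
    fix x y assume xy: "x \<in> K" "y \<in> K"
    have "dist (f x) (f y) \<le> (\<Sum>i\<in>UNIV. \<bar>(f x - f y) $ i\<bar>)"
      unfolding dist_norm by (rule norm_le_l1_cart)
    also have "\<dots> \<le> (\<Sum>i\<in>UNIV. L i * dist x y)"
      using lipschitz_onD[OF L xy] by (intro sum_mono) (auto simp: dist_real_def)
    finally show "dist (f x) (f y) \<le> (\<Sum>i\<in>UNIV. L i) * dist x y"
      by (simp add: sum_distrib_right)
  qed
  then show ?thesis by blast
qed

lemma locally_lipschitz_on_compact: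
  assumes "locally_lipschitz f" "compact K"
  shows "\<exists>L. L-lipschitz_on K f"
proof -
  have ll: "local_lipschitz {0::real} K (\<lambda>_. f)"
  proof (rule local_lipschitzI)
    fix t :: real and x assume "x \<in> K"
    obtain e L where e: "e > 0" "L-lipschitz_on (ball x e) f"
      using assms(1) unfolding locally_lipschitz_def by blast
    have "cball x (e / 2) \<inter> K \<subseteq> ball x e" using e(1) by auto
    then have "L-lipschitz_on (cball x (e / 2) \<inter> K) f" using e(2) lipschitz_on_subset by blast
    then show "\<exists>u>0. \<exists>L. \<forall>t\<in>cball t u \<inter> {0::real}. L-lipschitz_on (cball x u \<inter> K) f"
      using e(1) by (intro exI[of _ "e / 2"]) auto
  qed
  obtain L where "\<And>t. t \<in> {0::real} \<Longrightarrow> L-lipschitz_on K f"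
    by (rule local_lipschitz_compact_implies_lipschitz[OF ll assms(2)]) auto
  then show ?thesis by blast
qed

lemma locally_lipschitz_continuous:
  assumes "locally_lipschitz f"
  shows "continuous_on A f"
proof -
  have "isCont f x" for x
  proof -
    obtain e L where e: "e > 0" "L-lipschitz_on (ball x e) f"
      using assms unfolding locally_lipschitz_def by blast
    then have "continuous_on (ball x e) f" by (intro lipschitz_on_continuous_on)
    then show ?thesis using e(1) by (simp add: continuous_on_eq_continuous_at)
  qed
  then show ?thesis by (simp add: continuous_at_imp_continuous_on)
qed

lemma continuous_grad:
  assumes A4: "\<And>i. locally_lipschitz (partial_deriv G i j)"
  shows "continuous_on A (grad G j)"
proof -
  have "grad G j = (\<lambda>U. \<chi> i. partial_deriv G i j U)"
    by (simp add: fun_eq_iff vec_eq_iff grad_def partial_deriv_def)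
  then show ?thesis
    using locally_lipschitz_continuous[OF A4] by (auto intro!: continuous_on_vec_lambda)
qed

text \<open>
  By the mean value inequality: the gradient is continuous because the partial derivatives are
  locally Lipschitz, hence bounded on the compact convex set.
\<close>
lemma G_lipschitz_on_compact:
  fixes G :: "real ^ 'N \<Rightarrow> real ^ 'N::finite"
  assumes diff: "\<And>U. G differentiable (at U)"
    and A4: "\<And>i. locally_lipschitz (partial_deriv G i j)"
    and C: "compact C" "convex C"
  shows "\<exists>L. L-lipschitz_on C (\<lambda>U. G U $ j)"
proof -
  have "bounded (grad G j ` C)"
    by (intro compact_imp_bounded compact_continuous_image continuous_grad A4 C)
  then obtain b where b: "b > 0" "\<And>U. U \<in> C \<Longrightarrow> norm (grad G j U) \<le> b"
    unfolding bounded_pos by auto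
  have "b-lipschitz_on C (\<lambda>U. G U $ j)"
  proof (rule bounded_derivative_imp_lipschitz)
    fix U assume U: "U \<in> C"
    show "((\<lambda>U. G U $ j) has_derivative (\<lambda>v. grad G j U \<bullet> v)) (at U within C)"
      by (rule has_derivative_at_withinI[OF has_derivative_grad[OF diff]])
    show "onorm (\<lambda>v. grad G j U \<bullet> v) \<le> b"
    proof (rule onorm_le)
      fix v
      have "norm (grad G j U \<bullet> v) \<le> norm (grad G j U) * norm v"
        by (simp add: Cauchy_Schwarz_ineq2)
      also have "\<dots> \<le> b * norm v" using b U by (intro mult_right_mono) auto
      finally show "norm (grad G j U \<bullet> v) \<le> b * norm v" .
    qed
  qed (use C b in auto)
  then show ?thesis by blast
qed

text \<open>
  On a compact set of positive densities every \<open>m j\<close> is bounded away from zero, so the logarithms and the division by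
  the total mass in \<open>H_tilde\<close> preserve the Lipschitz property.
\<close>
lemma F_bar_lipschitz_on_compact:
  fixes G :: "real ^ 'N \<Rightarrow> real ^ 'N::finite"
  assumes diff: "\<And>U. G differentiable (at U)"
    and A4: "\<And>i j. locally_lipschitz (partial_deriv G i j)"
    and K: "compact K" "convex K" "K \<subseteq> {z. positive_vec (fst z)}"
  shows "\<exists>L. L-lipschitz_on K (F_bar G k)"
proof -
  have pos: "fst z $ j > 0" if "z \<in> K" for z j using K(3) that by (auto simp: positive_vec_def)
  have snd: "compact (snd ` K)" "convex (snd ` K)"
    using K(1) by (auto intro!: compact_continuous_image continuous_intros
        convex_linear_image[OF _ K(2)] linear_snd)
  have comp: "\<exists>L. L-lipschitz_on K (\<lambda>z. f (snd z))" if f: "\<exists>L. L-lipschitz_on (snd ` K) f"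
    for f :: "real ^ 'N \<Rightarrow> real"
  proof -
    obtain L where L: "L-lipschitz_on (snd ` K) f" using f by blast
    obtain M where M: "M-lipschitz_on K (snd :: (real ^ 'N) \<times> (real ^ 'N) \<Rightarrow> _)"
      using lipschitz_on_of_bounded_linear[OF bounded_linear_snd] by blast
    show ?thesis using lipschitz_on_compose2[OF M L] by blast
  qed
  have m: "\<exists>L. L-lipschitz_on K (\<lambda>z. fst z $ j)" for j
    by (rule lipschitz_on_of_bounded_linear)
      (rule bounded_linear_compose[OF bounded_linear_vec_nth bounded_linear_fst])
  have g: "\<exists>L. L-lipschitz_on K (\<lambda>z. G (snd z) $ j)" for j
    by (intro comp G_lipschitz_on_compact diff A4 snd)
  have dg: "\<exists>L. L-lipschitz_on K (\<lambda>z. partial_deriv G j i (snd z))" for i j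
    by (intro comp locally_lipschitz_on_compact A4 snd)
  have const: "\<exists>L. L-lipschitz_on K (\<lambda>z. a)" for a :: real
    using lipschitz_on_constant by blast
  have add: "\<exists>L. L-lipschitz_on K (\<lambda>z. f z + g z)" 
    if "\<exists>L. L-lipschitz_on K f" "\<exists>L. L-lipschitz_on K g" for f g :: "_ \<Rightarrow> real"
    using that lipschitz_on_add by blast
  have uminus: "\<exists>L. L-lipschitz_on K (\<lambda>z. - f z)" 
    if "\<exists>L. L-lipschitz_on K f" for f :: "_ \<Rightarrow> real"
    using that lipschitz_on_minus by blast
  note rules = lipschitz_on_mult_exists[OF K(1)] lipschitz_on_sum_exists const add uminus
     lipschitz_on_ln_exists[OF K(1)] lipschitz_on_inverse_exists[OF K(1)] m g dg
  have mass: "(\<Sum>i\<in>UNIV. fst z $ i) > 0" if "z \<in> K" for z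
    using pos[OF that] by (intro sum_pos) auto
  have H: "\<exists>L. L-lipschitz_on K (\<lambda>z. H_tilde G k (fst z) (snd z))"
    unfolding H_tilde_def divide_inverse diff_conv_add_uminus
    by (intro rules pos mass) auto
  have "\<exists>L. L-lipschitz_on K (\<lambda>z. fst (F_bar G k z))"
  proof (rule lipschitz_on_vec_exists)
    fix j
    have "fst (F_bar G k z) $ j = fst z $ j *
        (- (G (snd z) $ j) + H_tilde G k (fst z) (snd z) + (1 / real k) * ln (fst z $ j))" for z
      by (simp add: F_bar_def case_prod_unfold)
    then show "\<exists>L. L-lipschitz_on K (\<lambda>z. fst (F_bar G k z) $ j)"
      by (simp only:) (intro rules H pos)
  qed
  moreover have "\<exists>L. L-lipschitz_on K (\<lambda>z. snd (F_bar G k z))"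
  proof (rule lipschitz_on_vec_exists)
    fix j
    have "snd (F_bar G k z) $ j = (\<Sum>i\<in>UNIV. partial_deriv G j i (snd z) * fst z $ i)" for z
      by (simp add: F_bar_def case_prod_unfold adjoint_linearization_def
          matrix_vector_mult_def transpose_def partial_deriv_def)
    then show "\<exists>L. L-lipschitz_on K (\<lambda>z. snd (F_bar G k z) $ j)"
      by (simp only:) (intro rules, auto)
  qed
  ultimately obtain L M where "L-lipschitz_on K (\<lambda>z. fst (F_bar G k z))"
    "M-lipschitz_on K (\<lambda>z. snd (F_bar G k z))" by blast
  from lipschitz_on_Pair[OF this] show ?thesis by auto
qed

section \<open>The Lyapunov function\<close>

text \<open>
  The Kullback-Leibler divergence of the reference density \<open>Mr\<close> from the density, written so that every
  summand is nonnegative, plus half the squared distance of \<open>U\<close> to the reference \<open>Ur\<close>. The reference is a parameter, since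
  it is chosen to be the stationary state for the asymptotics, and \<open>(1, 0)\<close> for the existence of the flow.
\<close>
definition lyapunov :: "real ^ 'N \<Rightarrow> real ^ 'N \<Rightarrow> (real ^ 'N) \<times> (real ^ 'N::finite) \<Rightarrow> real" where
  "lyapunov Mr Ur z =
     (\<Sum>j\<in>UNIV. Mr $ j * (ln (Mr $ j) - ln (fst z $ j)) + fst z $ j - Mr $ j)
     + (snd z - Ur) \<bullet> (snd z - Ur) / 2"

text \<open>
  The part of the decay rate of the Lyapunov function that is nonnegative for positive densities: both Bregman
  terms by convexity of \<open>G\<close>, the last by monotonicity of the logarithm.
\<close>
definition dissipation ::
    "(real ^ 'N \<Rightarrow> real ^ 'N) \<Rightarrow> nat \<Rightarrow> real ^ 'N \<Rightarrow> real ^ 'N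
       \<Rightarrow> (real ^ 'N) \<times> (real ^ 'N::finite) \<Rightarrow> real" where
  "dissipation G k Mr Ur z =
     (\<Sum>j\<in>UNIV. fst z $ j * bregman G j Ur (snd z))
     + (\<Sum>j\<in>UNIV. Mr $ j * bregman G j (snd z) Ur)
     + (1 / real k) * (\<Sum>j\<in>UNIV. (fst z $ j - Mr $ j) * (ln (fst z $ j) - ln (Mr $ j)))"

text \<open>
  The defect of the reference state in the stationary equations, paired with the displacement from it.
\<close>
definition residual ::
    "(real ^ 'N \<Rightarrow> real ^ 'N) \<Rightarrow> nat \<Rightarrow> real ^ 'N \<Rightarrow> real ^ 'N
       \<Rightarrow> (real ^ 'N) \<times> (real ^ 'N::finite) \<Rightarrow> real" where
  "residual G k Mr Ur z =
     (\<Sum>j\<in>UNIV. (fst z $ j - Mr $ j) * (G Ur $ j - (1 / real k) * ln (Mr $ j)))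
     - adjoint_linearization G Ur Mr \<bullet> (snd z - Ur)"

lemma relative_entropy_nonneg:
  fixes x y :: real
  assumes "x > 0" "y > 0"
  shows "y * (ln y - ln x) + x - y \<ge> 0"
    and "x \<noteq> y \<Longrightarrow> y * (ln y - ln x) + x - y > 0"
proof -
  have cancel: "y * ((x - y) / y) = x - y" using assms by simp
  have "y * (ln x - ln y) \<le> y * ((x - y) / y)"
    using assms by (intro mult_left_mono ln_diff_le) auto
  then show "y * (ln y - ln x) + x - y \<ge> 0" unfolding cancel by (simp add: algebra_simps)
  assume "x \<noteq> y"
  then have "y * (ln x - ln y) < y * ((x - y) / y)"
    using assms by (intro mult_strict_left_mono ln_diff_less) auto
  then show "y * (ln y - ln x) + x - y > 0" unfolding cancel by (simp add: algebra_simps)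
qed

lemma ln_monotone_product:
  fixes x y :: real
  assumes "x > 0" "y > 0"
  shows "(x - y) * (ln x - ln y) \<ge> 0" and "x \<noteq> y \<Longrightarrow> (x - y) * (ln x - ln y) > 0"
proof -
  show *: "(x - y) * (ln x - ln y) > 0" if "x \<noteq> y"
    using assms that by (cases "x < y") (auto intro: mult_neg_neg mult_pos_pos)
  then show "(x - y) * (ln x - ln y) \<ge> 0" by (cases "x = y") auto
qed

lemma lyapunov_nonneg_terms:
  assumes "positive_vec M" "positive_vec Mr" and V: "lyapunov Mr Ur (M, U) \<le> b"
  shows "Mr $ j * (ln (Mr $ j) - ln (M $ j)) + M $ j - Mr $ j \<le> b"
    and "(U - Ur) \<bullet> (U - Ur) / 2 \<le> b"
proof -
  let ?e = "\<lambda>j. Mr $ j * (ln (Mr $ j) - ln (M $ j)) + M $ j - Mr $ j"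
  have e: "?e j \<ge> 0" for j
    using assms by (intro relative_entropy_nonneg) (auto simp: positive_vec_def)
  have "?e j \<le> (\<Sum>j\<in>UNIV. ?e j)" by (rule member_le_sum) (use e in auto)
  moreover have "(\<Sum>j\<in>UNIV. ?e j) \<ge> 0" by (rule sum_nonneg) (rule e)
  moreover have "(U - Ur) \<bullet> (U - Ur) / 2 \<ge> 0" by simp
  ultimately show "?e j \<le> b" "(U - Ur) \<bullet> (U - Ur) / 2 \<le> b"
    using V unfolding lyapunov_def fst_conv snd_conv by linarith+
qed

lemma lyapunov_positive:
  assumes "positive_vec (fst z)" "positive_vec Mr" "z \<noteq> (Mr, Ur)"
  shows "lyapunov Mr Ur z > 0"
proof -
  obtain M U where z: "z = (M, U)" by (cases z)
  let ?e = "\<lambda>j. Mr $ j * (ln (Mr $ j) - ln (M $ j)) + M $ j - Mr $ j"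
  have e: "?e j \<ge> 0" for j
    using assms z by (intro relative_entropy_nonneg) (auto simp: positive_vec_def)
  consider "U \<noteq> Ur" | j where "M $ j \<noteq> Mr $ j" using assms(3) z by (auto simp: vec_eq_iff)
  then show ?thesis
  proof cases
    case 1
    moreover have "(\<Sum>j\<in>UNIV. ?e j) \<ge> 0" by (rule sum_nonneg) (rule e)
    ultimately show ?thesis unfolding lyapunov_def z by (simp add: add_nonneg_pos)
  next
    case 2
    have "?e j > 0" using assms z 2 by (intro relative_entropy_nonneg) (auto simp: positive_vec_def)
    then have "(\<Sum>j\<in>UNIV. ?e j) > 0" using e by (intro sum_pos2[of _ j]) auto
    then show ?thesis unfolding lyapunov_def z by (simp add: add_pos_nonneg)
  qed
qed

lemma lyapunov_at_reference: "lyapunov Mr Ur (Mr, Ur) = 0"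
  by (simp add: lyapunov_def)

lemma dissipation_nonneg:
  assumes diff: "\<And>U. G differentiable (at U)" and A3: "\<And>i. convex_on UNIV (\<lambda>U. G U $ i)"
    and pos: "positive_vec (fst z)" "positive_vec Mr"
  shows "dissipation G k Mr Ur z \<ge> 0"
  unfolding dissipation_def using pos
  by (intro add_nonneg_nonneg sum_nonneg mult_nonneg_nonneg[of "1 / real k"] mult_nonneg_nonneg[OF less_imp_le]
      bregman_nonneg[OF diff A3] ln_monotone_product) (auto simp: positive_vec_def)

text \<open>
  If the dissipation vanishes, the logarithmic term forces equal densities. As the reference density
  is positive, every Bregman distance from \<open>Ur\<close> to \<open>U\<close> vanishes too, and since these distances control the
  forward differences of \<open>U - Ur\<close>, all of those are zero. Then \<open>U - Ur\<close> is constant on the connected grid, and zero because the means agree.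
\<close>
lemma dissipation_positive:
  fixes G :: "real ^ 'N \<Rightarrow> real ^ 'N::finite" and c :: "'N \<Rightarrow> 'd::finite \<Rightarrow> nat"
  assumes grid: "uniform_periodic_grid n h c" and k: "k > 0"
    and diff: "\<And>U. G differentiable (at U)" and A3: "\<And>i. convex_on UNIV (\<lambda>U. G U $ i)"
    and A5: "\<And>U V. (1 / h\<^sup>2) * (\<Sum>i\<in>UNIV. \<Sum>j\<in>UNIV.
                 (forward_diff n c U i j - forward_diff n c V i j)\<^sup>2)
               \<le> \<rho> * (\<Sum>j\<in>UNIV. G U $ j - G V $ j - grad G j V \<bullet> (U - V))"
    and pos: "positive_vec (fst z)" "positive_vec Mr"
    and mean: "(\<Sum>j\<in>UNIV. snd z $ j) = (\<Sum>j\<in>UNIV. Ur $ j)"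
    and ne: "z \<noteq> (Mr, Ur)"
  shows "dissipation G k Mr Ur z > 0"
proof (rule ccontr)
  assume neg: "\<not> ?thesis"
  obtain M U where z: "z = (M, U)" by (cases z)
  let ?a = "\<Sum>j\<in>UNIV. M $ j * bregman G j Ur U"
  let ?b = "\<Sum>j\<in>UNIV. Mr $ j * bregman G j U Ur"
  let ?c = "\<Sum>j\<in>UNIV. (M $ j - Mr $ j) * (ln (M $ j) - ln (Mr $ j))"
  have M: "M $ j > 0" and Mr: "Mr $ j > 0" for j using pos z by (auto simp: positive_vec_def)
  have B: "bregman G j U V \<ge> 0" for j U V by (rule bregman_nonneg[OF diff A3])
  have a: "?a \<ge> 0" using M B by (intro sum_nonneg mult_nonneg_nonneg less_imp_le[OF M]) auto
  have b: "?b \<ge> 0" using Mr B by (intro sum_nonneg mult_nonneg_nonneg less_imp_le[OF Mr]) auto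
  have c: "?c \<ge> 0" by (intro sum_nonneg ln_monotone_product M Mr)
  have c': "(1 / real k) * ?c \<ge> 0" using c k by simp
  have "?a + ?b + (1 / real k) * ?c \<le> 0" using neg by (simp add: dissipation_def z)
  then have b0: "?b = 0" and "(1 / real k) * ?c = 0" using a b c' by linarith+
  then have c0: "?c = 0" using k by simp
  have "(M $ j - Mr $ j) * (ln (M $ j) - ln (Mr $ j)) = 0" for j
    using c0 by (subst (asm) sum_nonneg_eq_0_iff) (auto intro: ln_monotone_product M Mr)
  then have "M $ j = Mr $ j" for j
    using ln_monotone_product(2)[OF M Mr, of j j] by force
  then have MMr: "M = Mr" by (simp add: vec_eq_iff)
  have "Mr $ j * bregman G j U Ur = 0" for j
    using b0 by (subst (asm) sum_nonneg_eq_0_iff) (auto intro!: mult_nonneg_nonneg less_imp_le[OF Mr] B)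
  then have "bregman G j U Ur = 0" for j by (metis Mr less_irrefl mult_eq_0_iff)
  then have "(1 / h\<^sup>2) * (\<Sum>i\<in>UNIV. \<Sum>j\<in>UNIV.
      (forward_diff n c U i j - forward_diff n c Ur i j)\<^sup>2) \<le> 0"
    using A5[of U Ur] by (simp add: bregman_def)
  moreover have "h > 0" using grid by (simp add: uniform_periodic_grid_def)
  ultimately have "(\<Sum>i\<in>UNIV. \<Sum>j\<in>UNIV.
      (forward_diff n c U i j - forward_diff n c Ur i j)\<^sup>2) \<le> 0"
    by (simp add: divide_le_0_iff)
  then have "(\<Sum>i\<in>UNIV. \<Sum>j\<in>UNIV.
      (forward_diff n c U i j - forward_diff n c Ur i j)\<^sup>2) = 0"
    by (intro antisym sum_nonneg) auto
  then have "forward_diff n c U i j = forward_diff n c Ur i j" for i j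
    by (simp add: sum_nonneg_eq_0_iff sum_nonneg)
  then have "forward_diff n c (U - Ur) i j = 0" for i j
    by (simp add: forward_diff_def algebra_simps)
  then have const: "(U - Ur) $ i = (U - Ur) $ j" for i j
    by (rule grid_function_constant[OF grid])
  have "(U - Ur) $ j = 0" for j
  proof -
    have "(\<Sum>i\<in>UNIV. (U - Ur) $ i) = 0" using mean z by (simp add: sum_subtractf)
    moreover have "(\<Sum>i\<in>UNIV. (U - Ur) $ i) = (\<Sum>i\<in>(UNIV :: 'N set). (U - Ur) $ j)"
      by (rule sum.cong[OF refl const])
    ultimately have "real CARD('N) * (U - Ur) $ j = 0" by (simp only: sum_constant)
    then show ?thesis by simp
  qed
  then have "U = Ur" by (simp add: vec_eq_iff)
  then show False using MMr ne z by simp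
qed

text \<open>
  The factor \<open>m j\<close> in the flow turns the
  derivative of the divergence into a sum against \<open>M - Mr\<close>, from which the constant \<open>H_tilde\<close> drops out since the masses
  agree. The values of \<open>G\<close> that remain combine with the adjoint term of the \<open>U\<close> equation into Bregman distances: this
  is the duality (saddle point) structure of the mean-field game.
\<close>
lemma lyapunov_derivative_along_flow:
  fixes G :: "real ^ 'N \<Rightarrow> real ^ 'N::finite"
  assumes z: "(z has_vector_derivative - F_bar G k (z t)) (at t within I)"
    and pos: "positive_vec (fst (z t))"
    and mass: "(\<Sum>j\<in>UNIV. fst (z t) $ j) = (\<Sum>j\<in>UNIV. Mr $ j)"
  shows "((\<lambda>t. lyapunov Mr Ur (z t)) has_real_derivative
     - dissipation G k Mr Ur (z t) + residual G k Mr Ur (z t)) (at t within I)"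
proof -
  obtain M U where zt: "z t = (M, U)" by (cases "z t")
  have M: "M $ j > 0" for j using pos zt by (simp add: positive_vec_def)
  define q where "q j = - (G U $ j) + H_tilde G k M U + (1 / real k) * ln (M $ j)" for j
  let ?A = "adjoint_linearization G U M"
  have F: "F_bar G k (z t) = (\<chi> j. M $ j * q j, ?A)" by (simp add: zt F_bar_def q_def)
  have m: "((\<lambda>t. fst (z t) $ j) has_real_derivative - (M $ j * q j)) (at t within I)" for j
    using bounded_linear.has_vector_derivative[OF bounded_linear_compose[OF bounded_linear_vec_nth bounded_linear_fst] z]
    by (simp add: F has_real_derivative_iff_has_vector_derivative)
  have u: "((\<lambda>t. snd (z t) - Ur) has_vector_derivative - ?A) (at t within I)"
    using bounded_linear.has_vector_derivative[OF bounded_linear_snd z]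
    by (auto intro!: derivative_eq_intros simp: F)
  have uu: "((\<lambda>t. (snd (z t) - Ur) \<bullet> (snd (z t) - Ur)) has_real_derivative - 2 * (?A \<bullet> (U - Ur))) (at t within I)"
    unfolding has_real_derivative_iff_has_vector_derivative
    using bounded_bilinear.has_vector_derivative[OF bounded_bilinear_inner u u]
    by (simp add: inner_commute zt)
  have e: "((\<lambda>t. Mr $ j * (ln (Mr $ j) - ln (fst (z t) $ j)) + fst (z t) $ j - Mr $ j)
      has_real_derivative - ((M $ j - Mr $ j) * q j)) (at t within I)" for j
    using M[of j] by (auto intro!: derivative_eq_intros m simp: zt field_simps)
  have d: "((\<lambda>t. lyapunov Mr Ur (z t)) has_real_derivative
     (\<Sum>j\<in>UNIV. - ((M $ j - Mr $ j) * q j)) + - 2 * (?A \<bullet> (U - Ur)) / 2) (at t within I)"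
    unfolding lyapunov_def by (intro DERIV_add DERIV_sum DERIV_cdivide e uu)
  let ?g = "\<lambda>V j. grad G j V \<bullet> (U - Ur)"
  have mass': "(\<Sum>j\<in>UNIV. M $ j - Mr $ j) = 0" using mass by (simp add: zt sum_subtractf)
  have "(\<Sum>j\<in>UNIV. - ((M $ j - Mr $ j) * q j)) = 
      (\<Sum>j\<in>UNIV. (M $ j - Mr $ j) * (G U $ j - (1 / real k) * ln (M $ j)) 
         - H_tilde G k M U * (M $ j - Mr $ j))"
    by (intro sum.cong) (simp_all add: q_def algebra_simps)
  also have "\<dots> = (\<Sum>j\<in>UNIV. (M $ j - Mr $ j) * (G U $ j - (1 / real k) * ln (M $ j)))"
    using mass' by (simp add: sum_subtractf sum_distrib_left[symmetric])
  also have "\<dots> - ?A \<bullet> (U - Ur)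
      = (\<Sum>j\<in>UNIV. (M $ j - Mr $ j) * (G U $ j - (1 / real k) * ln (M $ j)) - M $ j * ?g U j)"
    by (simp add: adjoint_linearization_inner sum_subtractf)
  also have "\<dots> = (\<Sum>j\<in>UNIV. 
        - (M $ j * bregman G j Ur U) - Mr $ j * bregman G j U Ur
        - (1 / real k) * ((M $ j - Mr $ j) * (ln (M $ j) - ln (Mr $ j)))
        + (M $ j - Mr $ j) * (G Ur $ j - (1 / real k) * ln (Mr $ j))
        - Mr $ j * ?g Ur j)"
    by (intro sum.cong) (simp_all add: bregman_def inner_diff_right algebra_simps diff_divide_distrib)
  also have "\<dots> = - dissipation G k Mr Ur (z t) + residual G k Mr Ur (z t)"
    by (simp add: dissipation_def residual_def zt adjoint_linearization_inner
        sum.distrib sum_subtractf sum_negf sum_distrib_left)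
  finally show ?thesis using d by simp
qed

section \<open>Conserved quantities and bounds along the flow\<close>

abbreviation flow_solution ::
    "(real ^ 'N \<Rightarrow> real ^ 'N) \<Rightarrow> nat \<Rightarrow> (real ^ 'N) \<times> (real ^ 'N) \<Rightarrow> real set
       \<Rightarrow> (real \<Rightarrow> (real ^ 'N) \<times> (real ^ 'N::finite)) \<Rightarrow> bool" where
  "flow_solution G k \<equiv> solution_on (\<lambda>z. - F_bar G k z) {z. positive_vec (fst z)}"

lemma solves_flow_iff: "solves_flow G k M0 U0 z \<longleftrightarrow> flow_solution G k (M0, U0) {0..} z"
  by (auto simp: solves_flow_def solution_on_def)

lemma flow_domain: 
  "open {z :: (real ^ 'N) \<times> (real ^ 'N::finite). positive_vec (fst z)}" 
  "convex {z :: (real ^ 'N) \<times> (real ^ 'N). positive_vec (fst z)}"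
proof -
  have "open {z :: (real ^ 'N) \<times> (real ^ 'N). 0 < fst z $ j}" for j
    by (intro open_Collect_less continuous_intros)
  then show "open {z :: (real ^ 'N) \<times> (real ^ 'N). positive_vec (fst z)}"
    unfolding positive_vec_def Collect_all_eq by auto
  show "convex {z :: (real ^ 'N) \<times> (real ^ 'N). positive_vec (fst z)}"
    unfolding convex_def positive_vec_def
  proof (clarsimp)
    fix x y :: "real ^ 'N" and u v :: real and i
    assume xy: "\<forall>i. 0 < x $ i" "\<forall>i. 0 < y $ i" and uv: "0 \<le> u" "0 \<le> v" "u + v = 1"
    then consider "u > 0" | "v > 0" by force
    then show "0 < u * x $ i + v * y $ i"
      by cases (use xy uv in \<open>auto intro: add_pos_nonneg add_nonneg_pos simp: less_imp_le\<close>)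
  qed
qed

text \<open>
  This is what \<open>H_tilde\<close> is for: it is the multiplier that keeps the total mass constant.
\<close>
lemma F_bar_mass_zero:
  fixes G :: "real ^ 'N \<Rightarrow> real ^ 'N::finite"
  assumes "positive_vec M"
  shows "(\<Sum>j\<in>UNIV. fst (F_bar G k (M, U)) $ j) = 0"
proof -
  have "(\<Sum>j\<in>UNIV. M $ j) > 0" using assms by (intro sum_pos) (auto simp: positive_vec_def)
  then have "H_tilde G k M U * (\<Sum>j\<in>UNIV. M $ j)
      = (\<Sum>j\<in>UNIV. M $ j * G U $ j - (1 / real k) * (M $ j) * ln (M $ j))"
    by (simp add: H_tilde_def)
  moreover have "(\<Sum>j\<in>UNIV. fst (F_bar G k (M, U)) $ j)
      = H_tilde G k M U * (\<Sum>j\<in>UNIV. M $ j)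
        - (\<Sum>j\<in>UNIV. M $ j * G U $ j - (1 / real k) * (M $ j) * ln (M $ j))"
    unfolding sum_distrib_left sum_subtractf[symmetric]
    by (intro sum.cong) (simp_all add: F_bar_def algebra_simps)
  ultimately show ?thesis by simp
qed

text \<open>
  The mean of \<open>U\<close> is conserved because \<open>G\<close> does not see constants: the adjoint is paired with a vector
  in the kernel of the linearization.
\<close>
lemma F_bar_mean_zero:
  fixes G :: "real ^ 'N \<Rightarrow> real ^ 'N::finite"
  assumes "\<And>j. grad G j U \<bullet> vec 1 = 0"
  shows "(\<Sum>j\<in>UNIV. snd (F_bar G k (M, U)) $ j) = 0"
proof -
  have "(\<Sum>j\<in>UNIV. snd (F_bar G k (M, U)) $ j) = adjoint_linearization G U M \<bullet> vec 1"
    by (simp add: F_bar_def inner_vec_def)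
  also have "\<dots> = 0" by (simp only: adjoint_linearization_inner assms) simp
  finally show ?thesis .
qed

lemma linear_invariant:
  assumes z: "solution_on f S x0 {0..T} z" and l: "bounded_linear l"
    and zero: "\<And>x. x \<in> S \<Longrightarrow> l (f x) = (0::real)" and t: "t \<in> {0..T}"
  shows "l (z t) = l x0"
proof -
  have "((\<lambda>t. l (z t)) has_real_derivative 0) (at t within {0..T})" if "t \<in> {0..T}" for t
  proof -
    have "(z has_vector_derivative f (z t)) (at t within {0..T})" "l (f (z t)) = 0"
      using z zero that by (auto simp: solution_on_def)
    then show ?thesis
      using bounded_linear.has_vector_derivative[OF l]
      by (metis has_real_derivative_iff_has_vector_derivative)
  qed
  then obtain b where "\<And>t. t \<in> {0..T} \<Longrightarrow> l (z t) = b"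
    using has_field_derivative_zero_constant[of "{0..T}" "\<lambda>t. l (z t)"] by auto
  from this[OF t] this[of 0] t z show ?thesis by (simp add: solution_on_def)
qed

lemma mass_conserved:
  assumes z: "flow_solution G k (M0, U0) {0..T} z" and t: "t \<in> {0..T}"
  shows "(\<Sum>j\<in>UNIV. fst (z t) $ j) = (\<Sum>j\<in>UNIV. M0 $ j)"
proof -
  have "(\<Sum>j\<in>UNIV. fst (z t) $ j) = (\<Sum>j\<in>UNIV. fst (M0, U0) $ j)"
  proof (rule linear_invariant[OF z _ _ t])
    show "bounded_linear (\<lambda>x :: (real ^ 'a) \<times> (real ^ 'a). \<Sum>j\<in>UNIV. fst x $ j)"
      by (intro bounded_linear_sum bounded_linear_compose[OF bounded_linear_vec_nth bounded_linear_fst])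
  qed (auto simp: F_bar_mass_zero sum_negf)
  then show ?thesis by simp
qed

lemma mean_conserved:
  assumes grad: "\<And>U j. grad G j U \<bullet> vec 1 = 0"
    and z: "flow_solution G k (M0, U0) {0..T} z" and t: "t \<in> {0..T}"
  shows "(\<Sum>j\<in>UNIV. snd (z t) $ j) = (\<Sum>j\<in>UNIV. U0 $ j)"
proof -
  have "(\<Sum>j\<in>UNIV. snd (z t) $ j) = (\<Sum>j\<in>UNIV. snd (M0, U0) $ j)"
  proof (rule linear_invariant[OF z _ _ t])
    show "bounded_linear (\<lambda>x :: (real ^ 'a) \<times> (real ^ 'a). \<Sum>j\<in>UNIV. snd x $ j)"
      by (intro bounded_linear_sum bounded_linear_compose[OF bounded_linear_vec_nth bounded_linear_snd])
  qed (auto simp: F_bar_mean_zero[OF grad] sum_negf)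
  then show ?thesis by simp
qed

text \<open>
  A compact set of positive densities that contains the states of mass at most \<open>a\<close> with Lyapunov value at most \<open>b\<close>.
  The lower bound on \<open>m j\<close> is where a single divergence summand reaches \<open>b\<close>, up to the dropped nonnegative term \<open>m j\<close>.
\<close>
definition sublevel_box ::
    "real ^ 'N \<Rightarrow> real ^ 'N \<Rightarrow> real \<Rightarrow> real \<Rightarrow> ((real ^ 'N) \<times> (real ^ 'N::finite)) set" where
  "sublevel_box Mr Ur a b =
     cbox (\<chi> j. Mr $ j * exp (- b / Mr $ j - 1)) (vec a) \<times> cball Ur (sqrt (2 * b))"

lemma compact_sublevel_box: "compact (sublevel_box Mr Ur a b)"
  unfolding sublevel_box_def by (intro compact_Times) auto

lemma sublevel_box_positive:
  assumes "positive_vec Mr" "z \<in> sublevel_box Mr Ur a b"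
  shows "positive_vec (fst z)"
proof -
  have "fst z $ j \<ge> Mr $ j * exp (- b / Mr $ j - 1)" for j
    using assms(2) by (auto simp: sublevel_box_def mem_box_cart)
  moreover have "Mr $ j * exp (- b / Mr $ j - 1) > 0" for j
    using assms(1) by (simp add: positive_vec_def)
  ultimately show ?thesis unfolding positive_vec_def by (meson less_le_trans)
qed

lemma lyapunov_sublevel_subset_box:
  assumes pos: "positive_vec (fst z)" "positive_vec Mr"
    and mass: "(\<Sum>j\<in>UNIV. fst z $ j) \<le> a"
    and V: "lyapunov Mr Ur z \<le> b"
  shows "z \<in> sublevel_box Mr Ur a b"
proof -
  obtain M U where z: "z = (M, U)" by (cases z)
  have M: "M $ j > 0" and Mr: "Mr $ j > 0" for j using pos z by (auto simp: positive_vec_def)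
  have up: "M $ j \<le> a" for j
    using member_le_sum[of j UNIV "\<lambda>j. M $ j"] less_imp_le[OF M] mass z by force
  have low: "Mr $ j * exp (- b / Mr $ j - 1) \<le> M $ j" for j
  proof -
    have "Mr $ j * (ln (Mr $ j) - ln (M $ j)) + M $ j - Mr $ j \<le> b"
      using lyapunov_nonneg_terms(1)[of M Mr Ur U b j] pos V z by simp
    then have "Mr $ j * (ln (Mr $ j) - ln (M $ j)) \<le> b + Mr $ j" using M[of j] by simp
    also have "\<dots> = Mr $ j * (b / Mr $ j + 1)" using Mr[of j] by (simp add: algebra_simps)
    finally have "ln (Mr $ j) - ln (M $ j) \<le> b / Mr $ j + 1"
      using Mr[of j] by simp
    then have "ln (Mr $ j) + (- b / Mr $ j - 1) \<le> ln (M $ j)" by simp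
    then have "exp (ln (Mr $ j) + (- b / Mr $ j - 1)) \<le> exp (ln (M $ j))" by (simp only: exp_le_cancel_iff)
    then show ?thesis using M[of j] Mr[of j] by (simp only: exp_add exp_ln)
  qed
  have "(U - Ur) \<bullet> (U - Ur) / 2 \<le> b"
    using lyapunov_nonneg_terms(2)[of M Mr Ur U b] pos V z by simp
  then have "(norm (U - Ur))\<^sup>2 \<le> 2 * b" by (simp add: dot_square_norm)
  then have "dist Ur U \<le> sqrt (2 * b)"
    by (simp add: dist_norm norm_minus_commute real_le_rsqrt)
  then show ?thesis
    using up low by (auto simp: z sublevel_box_def mem_box_cart)
qed

text \<open>
  Gronwall: \<open>exp (- t) (g t + a)\<close> is nonincreasing.
\<close>
lemma exponential_bound:
  fixes g :: "real \<Rightarrow> real"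
  assumes "s \<ge> 0"
    and D: "\<And>t. t \<in> {0..s} \<Longrightarrow> (g has_real_derivative g' t) (at t within {0..s})"
    and N: "\<And>t. t \<in> {0..s} \<Longrightarrow> g' t \<le> a + g t"
  shows "g s + a \<le> exp s * (g 0 + a)"
proof -
  have "exp (- s) * (g s + a) \<le> exp (- 0) * (g 0 + a)"
  proof (rule nonincreasing_if_derivative_nonpos[where g = "\<lambda>t. exp (- t) * (g t + a)"
        and g' = "\<lambda>t. exp (- t) * (g' t - (a + g t))"])
    fix t assume t: "t \<in> {0..s}"
    show "((\<lambda>t. exp (- t) * (g t + a)) has_real_derivative exp (- t) * (g' t - (a + g t))) (at t within {0..s})"
      by (auto intro!: derivative_eq_intros D[OF t] simp: algebra_simps)
    show "exp (- t) * (g' t - (a + g t)) \<le> 0"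
      using N[OF t] by (simp add: mult_le_0_iff)
  qed fact
  then have "exp s * (exp (- s) * (g s + a)) \<le> exp s * (g 0 + a)" by simp
  then show ?thesis by (simp add: mult.assoc[symmetric] exp_add[symmetric])
qed

text \<open>
  With the reference \<open>(1, 0)\<close> the logarithm of the reference density vanishes, the density part of the residual is bounded
  in terms of the mass, and the linear term in \<open>U\<close> is absorbed by the quadratic part of the Lyapunov function.
\<close>
lemma residual_bound_at_rest:
  fixes G :: "real ^ 'N \<Rightarrow> real ^ 'N::finite"
  assumes pos: "positive_vec (fst z)" and mass: "(\<Sum>j\<in>UNIV. fst z $ j) = b"
  shows "residual G k (vec 1) 0 z \<le> 
     (b + 1) * (\<Sum>j\<in>UNIV. \<bar>G 0 $ j\<bar>) + (norm (adjoint_linearization G 0 (vec 1)))\<^sup>2 / 2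
      + lyapunov (vec 1) 0 z"
proof -
  obtain M U where z: "z = (M, U)" by (cases z)
  have M: "M $ j > 0" for j using pos z by (simp add: positive_vec_def)
  have Mb: "M $ j \<le> b" for j
    using member_le_sum[of j UNIV "\<lambda>j. M $ j"] less_imp_le[OF M] mass z by force
  let ?A = "adjoint_linearization G 0 (vec 1)"
  have "(\<Sum>j\<in>UNIV. (M $ j - 1) * G 0 $ j) \<le> (\<Sum>j\<in>UNIV. (b + 1) * \<bar>G 0 $ j\<bar>)"
  proof (rule sum_mono)
    fix j
    have "(M $ j - 1) * G 0 $ j \<le> \<bar>M $ j - 1\<bar> * \<bar>G 0 $ j\<bar>" by (metis abs_ge_self abs_mult)
    also have "\<dots> \<le> (b + 1) * \<bar>G 0 $ j\<bar>"
      using M[of j] Mb[of j] by (intro mult_right_mono) auto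
    finally show "(M $ j - 1) * G 0 $ j \<le> (b + 1) * \<bar>G 0 $ j\<bar>" .
  qed
  moreover have "- (?A \<bullet> U) \<le> (norm ?A)\<^sup>2 / 2 + U \<bullet> U / 2"
  proof -
    have "0 \<le> (?A + U) \<bullet> (?A + U)" by (rule inner_ge_zero)
    also have "\<dots> = (norm ?A)\<^sup>2 + 2 * (?A \<bullet> U) + U \<bullet> U"
      by (simp only: inner_add_left inner_add_right inner_commute[of U ?A] power2_norm_eq_inner)
    finally show ?thesis by simp
  qed
  moreover have "U \<bullet> U / 2 \<le> lyapunov (vec 1) 0 z"
    using lyapunov_nonneg_terms(2)[of M "vec 1" 0 U "lyapunov (vec 1) 0 z"] pos z
    by (simp add: positive_vec_def)
  ultimately show ?thesis
    by (simp add: residual_def z sum_distrib_left)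
qed

text \<open>
  With the reference \<open>(1, 0)\<close> the Lyapunov function grows at most exponentially.
  That excludes blow-up and vanishing of the density in finite time.
\<close>
lemma flow_a_priori_bound:
  fixes G :: "real ^ 'N \<Rightarrow> real ^ 'N::finite"
  assumes diff: "\<And>U. G differentiable (at U)" and A3: "\<And>i. convex_on UNIV (\<lambda>U. G U $ i)"
    and mass: "(\<Sum>j\<in>UNIV. M0 $ j) = real CARD('N)"
  shows "\<exists>C. compact C \<and> C \<subseteq> {z. positive_vec (fst z)} \<and>
    (\<forall>s z. 0 \<le> s \<longrightarrow> s \<le> T \<longrightarrow> flow_solution G k (M0, U0) {0..s} z \<longrightarrow> z s \<in> C)"
proof -
  let ?V = "lyapunov (vec 1) 0 :: (real ^ 'N) \<times> (real ^ 'N) \<Rightarrow> real"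
  let ?N = "real CARD('N)"
  have one: "positive_vec (vec 1 :: real ^ 'N)" by (simp add: positive_vec_def)
  define a where "a = (?N + 1) * (\<Sum>j\<in>UNIV. \<bar>G 0 $ j\<bar>) + (norm (adjoint_linearization G 0 (vec 1)))\<^sup>2 / 2"
  have a: "a \<ge> 0" unfolding a_def by (intro add_nonneg_nonneg mult_nonneg_nonneg sum_nonneg) auto
  define b where "b = exp T * (\<bar>?V (M0, U0)\<bar> + a)"
  show ?thesis
  proof (intro exI[of _ "sublevel_box (vec 1) 0 ?N b"] conjI allI impI)
    show "sublevel_box (vec 1 :: real ^ 'N) 0 ?N b \<subseteq> {z. positive_vec (fst z)}"
      using sublevel_box_positive[OF one] by blast
    fix s z
    assume s: "0 \<le> s" "s \<le> T" and z: "flow_solution G k (M0, U0) {0..s} z"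
    have pos: "positive_vec (fst (z t))" if "t \<in> {0..s}" for t
      using z that by (simp add: solution_on_def)
    have m: "(\<Sum>j\<in>UNIV. fst (z t) $ j) = ?N" if "t \<in> {0..s}" for t
      using mass_conserved[OF z that] mass by simp
    have "?V (z s) + a \<le> exp s * (?V (z 0) + a)"
    proof (rule exponential_bound[where g = "\<lambda>t. ?V (z t)"])
      fix t assume t: "t \<in> {0..s}"
      show "((\<lambda>t. ?V (z t)) has_real_derivative
          - dissipation G k (vec 1) 0 (z t) + residual G k (vec 1) 0 (z t)) (at t within {0..s})"
        using z t by (intro lyapunov_derivative_along_flow pos) (auto simp: solution_on_def m)
      have "dissipation G k (vec 1) 0 (z t) \<ge> 0"
        by (rule dissipation_nonneg[OF diff A3 pos[OF t] one])
      then show "- dissipation G k (vec 1) 0 (z t) + residual G k (vec 1) 0 (z t) \<le> a + ?V (z t)"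
        using residual_bound_at_rest[OF pos[OF t] m[OF t], of G k] unfolding a_def by simp
    qed (rule s)
    also have "\<dots> \<le> exp s * (\<bar>?V (M0, U0)\<bar> + a)"
      using z by (intro mult_left_mono) (auto simp: solution_on_def)
    also have "\<dots> \<le> b"
      unfolding b_def using s a by (intro mult_right_mono) auto
    finally have "?V (z s) \<le> b" using a by simp
    then show "z s \<in> sublevel_box (vec 1) 0 ?N b"
      using s by (intro lyapunov_sublevel_subset_box pos one) (auto simp: m)
  qed (rule compact_sublevel_box)
qed

section \<open>Convergence to the stationary state\<close>

text \<open>
  At a stationary state \<open>G - ln m / k\<close> is the same number at every vertex, so its sum against a
  difference of densities of equal mass vanishes; the adjoint part is zero by the second equation.
\<close>
lemma residual_zero_at_stationary:
  fixes G :: "real ^ 'N \<Rightarrow> real ^ 'N::finite"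
  assumes st: "solves_stationary G k Ms Us"
    and mass: "(\<Sum>j\<in>UNIV. fst z $ j) = (\<Sum>j\<in>UNIV. Ms $ j)"
  shows "residual G k Ms Us z = 0"
proof -
  have F: "F_tilde G k (Ms, Us) = (0, 0)" using st by (simp add: solves_stationary_def zero_prod_def)
  then have A: "adjoint_linearization G Us Ms = 0" by (simp add: F_tilde_def)
  have "- (G Us $ j) + H_tilde G k Ms Us + (1 / real k) * ln (Ms $ j) = 0" for j
    using F by (simp add: F_tilde_def vec_eq_iff)
  then have g: "G Us $ j - (1 / real k) * ln (Ms $ j) = H_tilde G k Ms Us" for j
    by (smt (verit))
  have "(\<Sum>j\<in>UNIV. (fst z $ j - Ms $ j) * (G Us $ j - (1 / real k) * ln (Ms $ j)))
     = (\<Sum>j\<in>UNIV. fst z $ j - Ms $ j) * H_tilde G k Ms Us"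
    by (simp only: g sum_distrib_right)
  also have "\<dots> = 0" using mass by (simp add: sum_subtractf)
  finally show ?thesis by (simp add: residual_def A)
qed

lemma continuous_on_lyapunov:
  assumes "\<And>z. z \<in> K \<Longrightarrow> positive_vec (fst z)"
  shows "continuous_on K (lyapunov Mr Ur)"
  unfolding lyapunov_def[abs_def]
  by (intro continuous_intros) (use assms in \<open>auto simp: positive_vec_def less_imp_neq[symmetric]\<close>)

lemma continuous_on_dissipation:
  fixes G :: "real ^ 'N \<Rightarrow> real ^ 'N::finite"
  assumes diff: "\<And>U. G differentiable (at U)"
    and A4: "\<And>i j. locally_lipschitz (partial_deriv G j i)"
    and K: "\<And>z. z \<in> K \<Longrightarrow> positive_vec (fst z)"
  shows "continuous_on K (dissipation G k Mr Ur)"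
proof -
  have "continuous_on UNIV G"
    by (intro differentiable_imp_continuous_on differentiable_at_imp_differentiable_on diff)
  then have G: "continuous_on K (\<lambda>z. G (snd z))"
    by (rule continuous_on_compose2) (auto intro: continuous_intros)
  have g: "continuous_on K (\<lambda>z. grad G j (snd z))" for j
    by (rule continuous_on_compose2[OF continuous_grad[OF A4, of UNIV]]) (auto intro: continuous_intros)
  show ?thesis
    unfolding dissipation_def[abs_def] bregman_def
    by (intro continuous_intros G g) (use K in \<open>auto simp: positive_vec_def less_imp_neq[symmetric]\<close>)
qed

text \<open>
  With the stationary state as reference the Lyapunov function decays exactly at the rate of the dissipation. The compact set
  is cut by the conserved mean of \<open>U\<close>, which is what separates \<open>Us\<close> from its translates by constants.
\<close>
lemma flow_converges:
  fixes G :: "real ^ 'N \<Rightarrow> real ^ 'N::finite" and c :: "'N \<Rightarrow> 'd::finite \<Rightarrow> nat"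
  assumes grid: "uniform_periodic_grid n h c" and k: "k > 0"
    and diff: "\<And>U. G differentiable (at U)" and A3: "\<And>i. convex_on UNIV (\<lambda>U. G U $ i)"
    and A4: "\<And>i j. locally_lipschitz (partial_deriv G j i)"
    and A5: "\<And>U V. (1 / h\<^sup>2) * (\<Sum>i\<in>UNIV. \<Sum>j\<in>UNIV.
                 (forward_diff n c U i j - forward_diff n c V i j)\<^sup>2)
               \<le> \<rho> * (\<Sum>j\<in>UNIV. G U $ j - G V $ j - grad G j V \<bullet> (U - V))"
    and A6: "\<And>j U s. G (U + vec s) $ j = G U $ j"
    and z: "flow_solution G k (M0, U0) {0..} z"
    and st: "solves_stationary G k Ms Us"
    and M0: "(\<Sum>j\<in>UNIV. M0 $ j) = (\<Sum>j\<in>UNIV. Ms $ j)"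
    and U0: "(\<Sum>j\<in>UNIV. U0 $ j) = (\<Sum>j\<in>UNIV. Us $ j)"
  shows "(z \<longlongrightarrow> (Ms, Us)) at_top"
proof -
  have Ms: "positive_vec Ms" using st by (simp add: solves_stationary_def)
  have sub: "flow_solution G k (M0, U0) {0..t} z" for t by (rule solution_on_subset[OF z]) auto
  have pos: "positive_vec (fst (z t))" if "t \<ge> 0" for t
    using z that by (simp add: solution_on_def)
  have mass: "(\<Sum>j\<in>UNIV. fst (z t) $ j) = (\<Sum>j\<in>UNIV. Ms $ j)" if "t \<ge> 0" for t
    using mass_conserved[OF sub, of t t] that M0 by simp
  have mean: "(\<Sum>j\<in>UNIV. snd (z t) $ j) = (\<Sum>j\<in>UNIV. Us $ j)" if "t \<ge> 0" for t
    using mean_conserved[OF grad_orthogonal_to_constants[OF diff A6] sub, of t t] that U0 by simp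
  let ?V = "lyapunov Ms Us" and ?D = "dissipation G k Ms Us"
  have deriv: "((\<lambda>t. ?V (z t)) has_real_derivative - ?D (z t)) (at t within {0..})" if "t \<ge> 0" for t
    using lyapunov_derivative_along_flow[of z G k t "{0..}" Ms Us] z that pos[OF that] mass[OF that]
      residual_zero_at_stationary[OF st mass[OF that]] by (simp add: solution_on_def)
  define b where "b = ?V (z 0)"
  have V: "?V (z t) \<le> b" if t: "t \<ge> 0" for t
    unfolding b_def
  proof (rule nonincreasing_if_derivative_nonpos[where g = "\<lambda>t. ?V (z t)" and g' = "\<lambda>t. - ?D (z t)"])
    fix s assume s: "s \<in> {0..t}"
    show "((\<lambda>t. ?V (z t)) has_real_derivative - ?D (z s)) (at s within {0..t})"
      using s by (intro has_field_derivative_subset[OF deriv]) auto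
    show "- ?D (z s) \<le> 0" using dissipation_nonneg[OF diff A3 pos Ms] s by auto
  qed (rule t)
  define K where "K = sublevel_box Ms Us (\<Sum>j\<in>UNIV. Ms $ j) b
     \<inter> {z. (\<Sum>j\<in>UNIV. snd z $ j) = (\<Sum>j\<in>UNIV. Us $ j)}"
  have Kpos: "positive_vec (fst x)" if "x \<in> K" for x
    using that unfolding K_def by (intro sublevel_box_positive[OF Ms]) (rule IntD1)
  show ?thesis
  proof (rule lyapunov_convergence[where K = K and V = ?V and D = ?D])
    show "compact K"
      unfolding K_def
      by (intro compact_Int_closed compact_sublevel_box closed_Collect_eq continuous_intros)
    show "z t \<in> K" if "t \<ge> 0" for t
      unfolding K_def using that by (auto intro!: lyapunov_sublevel_subset_box pos Ms V simp: mean mass)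
    show "continuous_on K ?V" by (rule continuous_on_lyapunov) (rule Kpos)
    show "continuous_on K ?D" by (rule continuous_on_dissipation[OF diff A4]) (rule Kpos)
    show "?V x > ?V (Ms, Us)" if "x \<in> K" "x \<noteq> (Ms, Us)" for x
      using lyapunov_positive[OF Kpos[OF that(1)] Ms that(2)] by (simp add: lyapunov_at_reference)
    show "?D x \<ge> 0" if "x \<in> K" for x
      by (rule dissipation_nonneg[OF diff A3 Kpos[OF that] Ms])
    show "?D x > 0" if "x \<in> K" "x \<noteq> (Ms, Us)" for x
      using that by (intro dissipation_positive[OF grid k diff A3 A5 Kpos[OF that(1)] Ms]) (auto simp: K_def)
  qed (rule deriv)
qed

lemma solves_stationary_shift:
  fixes G :: "real ^ 'N \<Rightarrow> real ^ 'N::finite"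
  assumes diff: "\<And>U. G differentiable (at U)" and A6: "\<And>j U s. G (U + vec s) $ j = G U $ j"
    and st: "solves_stationary G k Ms Us"
  shows "solves_stationary G k Ms (Us + vec s)"
proof -
  have G: "G (U + vec s) = G U" for U by (simp add: vec_eq_iff A6)
  have "linearization G (Us + vec s) = linearization G Us"
    by (rule linearization_shift[OF diff G])
  then have "F_tilde G k (Ms, Us + vec s) = F_tilde G k (Ms, Us)"
    by (simp add: F_tilde_def G H_tilde_def adjoint_linearization_def)
  then show ?thesis using st by (simp add: solves_stationary_def)
qed

theorem theorem1p2:
  fixes n k :: nat and h \<rho> :: real
    and c :: "'N::finite \<Rightarrow> 'd::finite \<Rightarrow> nat"
    and G :: "real ^ 'N \<Rightarrow> real ^ 'N"
    and M0 U0 :: "real ^ 'N"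
  assumes grid: "uniform_periodic_grid n h c"
    and k: "k > 0"
    and G_diff: "\<And>U. G differentiable (at U)"
    and A3: "\<And>i. convex_on UNIV (\<lambda>U. G U $ i)"
    and A4: "\<And>i j. locally_lipschitz (partial_deriv G j i)"
    and A5: "\<And>U V. (1 / h\<^sup>2) * (\<Sum>i\<in>UNIV. \<Sum>j\<in>UNIV.
                 (forward_diff n c U i j - forward_diff n c V i j)\<^sup>2)
               \<le> \<rho> * (\<Sum>j\<in>UNIV. G U $ j - G V $ j - grad G j V \<bullet> (U - V))"
    and A6: "\<And>j U s. G (U + vec s) $ j = G U $ j"
    and M0_pos: "positive_vec M0"
    and M0_mean: "grid_mean M0 = 1"
    and U0_mean: "grid_mean U0 = 0"
  shows "\<exists>z. solves_flow G k M0 U0 z \<and>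
           (\<forall>w. solves_flow G k M0 U0 w \<longrightarrow> (\<forall>t\<ge>0. w t = z t)) \<and>
           (\<forall>Ms Us. solves_stationary G k Ms Us \<longrightarrow>
              (\<forall>j. ((\<lambda>t. fst (z t) $ j) \<longlongrightarrow> Ms $ j) at_top) \<and>
              (grid_mean Us = 0 \<longrightarrow>
                 (\<forall>j. ((\<lambda>t. snd (z t) $ j) \<longlongrightarrow> Us $ j) at_top)))"
proof -
  have M0: "(\<Sum>j\<in>UNIV. M0 $ j) = real CARD('N)"
    using M0_mean by (simp add: grid_mean_def field_simps)
  have U0: "(\<Sum>j\<in>UNIV. U0 $ j) = 0"
    using U0_mean by (simp add: grid_mean_def)
  have lip: "\<exists>L. L-lipschitz_on K (\<lambda>z. - F_bar G k z)"
    if "compact K" "convex K" "K \<subseteq> {z. positive_vec (fst z)}" for K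
    using F_bar_lipschitz_on_compact[OF G_diff A4 that] by simp
  have "\<exists>z. flow_solution G k (M0, U0) {0..} z \<and>
      (\<forall>w. flow_solution G k (M0, U0) {0..} w \<longrightarrow> (\<forall>t\<ge>0. w t = z t))"
    by (rule global_solution_if_bounded_a_priori[OF flow_domain lip])
      (use M0_pos flow_a_priori_bound[OF G_diff A3 M0] in auto)
  then obtain z where z: "flow_solution G k (M0, U0) {0..} z"
    and unique: "\<And>w. flow_solution G k (M0, U0) {0..} w \<Longrightarrow> \<forall>t\<ge>0. w t = z t"
    by blast
  \<comment> \<open>A stationary state is determined only up to a constant in \<open>U\<close>; the limit of the flow is
    the one with the mean of the initial datum.\<close>
  have conv: "(z \<longlongrightarrow> (Ms, Us + vec (- grid_mean Us))) at_top" if "solves_stationary G k Ms Us" for Ms Us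
  proof (rule flow_converges[OF grid k G_diff A3 A4 A5 A6 z])
    show st: "solves_stationary G k Ms (Us + vec (- grid_mean Us))"
      by (rule solves_stationary_shift[OF G_diff A6 that])
    show "(\<Sum>j\<in>UNIV. M0 $ j) = (\<Sum>j\<in>UNIV. Ms $ j)"
      using st M0 by (simp add: solves_stationary_def grid_mean_def field_simps)
    show "(\<Sum>j\<in>UNIV. U0 $ j) = (\<Sum>j\<in>UNIV. (Us + vec (- grid_mean Us)) $ j)"
      by (simp add: U0 sum.distrib sum_subtractf grid_mean_def)
  qed
  show ?thesis
  proof (intro exI[of _ z] conjI allI impI)
    show "solves_flow G k M0 U0 z" using z by (simp add: solves_flow_iff)
    show "w t = z t" if "solves_flow G k M0 U0 w" "t \<ge> 0" for w t
      using unique that by (simp add: solves_flow_iff)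
    fix Ms Us j assume st: "solves_stationary G k Ms Us"
    show "((\<lambda>t. fst (z t) $ j) \<longlongrightarrow> Ms $ j) at_top"
      using tendsto_vec_nth[OF tendsto_fst[OF conv[OF st]], of j] by simp
    assume "grid_mean Us = 0"
    then show "((\<lambda>t. snd (z t) $ j) \<longlongrightarrow> Us $ j) at_top"
      using tendsto_vec_nth[OF tendsto_snd[OF conv[OF st]], of j] by simp
  qed
qed

end
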